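(* Let $f\colon X\to Y$ be a BDD branched covering between metric spaces, with $N=N(f,X)<\infty$, where $X$ and $Y$ have bounded turning and $Y$ embeds bi-Lipschitzly into some Euclidean space. Then $X$ may also be embedded bi-Lipschitzly into some (possibly larger) Euclidean space. In particular, if $X$ is a locally compact quasiconvex metric space and $f\colon X\to\mathbb{R}^n$ is a BLD branched covering with finite maximal multiplicity $N(f,X)<\infty$, then $X$ embeds bi-Lipschitzly into some Euclidean space.
   Context: Standing assumptions: $X$ and $Y$ are locally compact, complete, connected and locally connected metric spaces. A branched covering is a continuous, open, discrete map of locally bounded multiplicity (each point has a neighborhood $U$ with $N(f,U)<\infty$), where $N(f,A)=\sup_y\#(f^{-1}(y)\cap A)$. $f$ is BDD if for some $L\ge1$, $L^{-1}\operatorname{diam}(\alpha)\le\operatorname{diam}(f\circ\alpha)\le L\operatorname{diam}(\alpha)$ for all non-constant curves $\alpha$ in $X$; $f$ is BLD if for some $L\ge1$, $L^{-1}l(\alpha)\le l(f\circ\alpha)\le Ll(\alpha)$ for all non-constant curves $\alpha$, $l$ denoting length. Bounded turning: for some $c$, every two points $x_1,x_2$ lie in a continuum of diameter at most $c\,d(x_1,x_2)$. Quasiconvex: for some $C$, every two points $x,y$ are joined by a curve of length at most $C\,d(x,y)$. *)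

theory Defs
  imports "HOL-Analysis.Analysis" "HOL-Library.Extended_Nat"
begin

text \<open>Metric spaces are types of class \<open>metric_space\<close>; a curve is a \<open>path\<close>, that is a continuous
  map on the unit interval, and its diameter is the diameter of its image.\<close>

definition standing_space :: "'a::metric_space set \<Rightarrow> bool" where
  "standing_space S \<longleftrightarrow> locally compact S \<and> complete S \<and> connected S \<and> locally connected S"

definition max_multiplicity :: "('a \<Rightarrow> 'b) \<Rightarrow> 'a set \<Rightarrow> enat" where
  "max_multiplicity f A =
    (SUP y. if finite (f -` {y} \<inter> A) then enat (card (f -` {y} \<inter> A)) else \<infinity>)"

definition branched_covering :: "('a::metric_space \<Rightarrow> 'b::metric_space) \<Rightarrow> bool" where
  "branched_covering f \<longleftrightarrow>
    continuous_on UNIV f \<and> open_map euclidean euclidean f \<and> (\<forall>y. discrete (f -` {y})) \<and>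
    (\<forall>x. \<exists>U. open U \<and> x \<in> U \<and> max_multiplicity f U < \<infinity>)"

definition nonconstant_curve :: "(real \<Rightarrow> 'a::metric_space) \<Rightarrow> bool" where
  "nonconstant_curve \<alpha> \<longleftrightarrow> path \<alpha> \<and> \<not> \<alpha> constant_on {0..1}"

text \<open>Length is the supremum over finite partitions; it is infinite for non-rectifiable curves.\<close>

definition curve_length :: "(real \<Rightarrow> 'a::metric_space) \<Rightarrow> ennreal" where
  "curve_length \<alpha> =
    (SUP ts \<in> {ts. sorted ts \<and> set ts \<subseteq> {0..1}}.
      \<Sum>i<length ts - 1. ennreal (dist (\<alpha> (ts ! i)) (\<alpha> (ts ! Suc i))))"

definition BDD :: "('a::metric_space \<Rightarrow> 'b::metric_space) \<Rightarrow> bool" where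
  "BDD f \<longleftrightarrow> (\<exists>L\<ge>1. \<forall>\<alpha>. nonconstant_curve \<alpha> \<longrightarrow>
    inverse L * diameter (path_image \<alpha>) \<le> diameter (path_image (f \<circ> \<alpha>)) \<and>
    diameter (path_image (f \<circ> \<alpha>)) \<le> L * diameter (path_image \<alpha>))"

definition BLD :: "('a::metric_space \<Rightarrow> 'b::metric_space) \<Rightarrow> bool" where
  "BLD f \<longleftrightarrow> (\<exists>L\<ge>1. \<forall>\<alpha>. nonconstant_curve \<alpha> \<longrightarrow>
    ennreal (inverse L) * curve_length \<alpha> \<le> curve_length (f \<circ> \<alpha>) \<and>
    curve_length (f \<circ> \<alpha>) \<le> ennreal L * curve_length \<alpha>)"

definition bounded_turning :: "'a::metric_space set \<Rightarrow> bool" where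
  "bounded_turning S \<longleftrightarrow> (\<exists>c::real. \<forall>x1\<in>S. \<forall>x2\<in>S. \<exists>K\<subseteq>S.
    compact K \<and> connected K \<and> x1 \<in> K \<and> x2 \<in> K \<and> diameter K \<le> c * dist x1 x2)"

definition quasiconvex :: "'a::metric_space set \<Rightarrow> bool" where
  "quasiconvex S \<longleftrightarrow> (\<exists>C::real. \<forall>x\<in>S. \<forall>y\<in>S. \<exists>\<alpha>.
    path \<alpha> \<and> path_image \<alpha> \<subseteq> S \<and> pathstart \<alpha> = x \<and> pathfinish \<alpha> = y \<and>
    curve_length \<alpha> \<le> ennreal (C * dist x y))"

text \<open>The dimension is existentially quantified, so the target is the library's
  \<open>Euclidean_space m\<close>, real sequences vanishing from index \<open>m\<close> on, with the Euclidean distance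
  written out through \<open>L2_set\<close>.\<close>

definition bilipschitz_embeds_Euclidean :: "'a::metric_space set \<Rightarrow> bool" where
  "bilipschitz_embeds_Euclidean S \<longleftrightarrow>
    (\<exists>(m::nat) (h :: 'a \<Rightarrow> nat \<Rightarrow> real) (L::real). L \<ge> 1 \<and>
      h ` S \<subseteq> topspace (Euclidean_space m) \<and>
      (\<forall>x\<in>S. \<forall>y\<in>S.
        inverse L * dist x y \<le> L2_set (\<lambda>i. h x i - h y i) {..<m} \<and>
        L2_set (\<lambda>i. h x i - h y i) {..<m} \<le> L * dist x y))"

end

theory Submission
  imports Defs
begin

text \<open>Lifting paths shows that a BDD or BLD branched covering \<open>f\<close> is a Lipschitz quotient onto its
  image: it is Lipschitz, and for all \<open>x\<close>, \<open>x'\<close> the fibre of \<open>f x\<close> meets the ball around \<open>x'\<close> of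
  radius \<open>C * dist (f x) (f x')\<close>. Openness and finite fibres give lifts locally, by following
  quasi-components of preimages of subpaths; the distortion bound and completeness make them
  global.

  A finite-to-one Lipschitz quotient embeds if its target does. The composite of \<open>f\<close> with the
  embedding of the target separates \<open>x\<close> and \<open>x'\<close> unless \<open>dist (f x) (f x')\<close> is much smaller than
  \<open>dist x x'\<close>. In that case the fibre of \<open>f x\<close> has a point at distance about \<open>dist x x'\<close> from \<open>x\<close>,
  so this happens at boundedly many scales for each \<open>x\<close>. Bump functions around nets of such points
  at each scale can therefore be distributed over finitely many colours such that bumps of equal
  colour neither overlap nor take the same value at two points that are to be separated. The bumps
  of one colour make up one additional coordinate.\<close>

section \<open>Finite selection principles and doubling spaces\<close>

text \<open>The conflicts between bumps need not form a graph of bounded degree: near a branch point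
  one bump may meet bumps of infinitely many smaller scales. What is bounded is the number of
  conflicts with bumps of the same or a larger scale. This suffices for colouring finite sets from
  the largest scale down, and compactness carries the colouring to the set of all bumps, where no
  smallest or largest scale need exist. The same compactness principle selects lifts of paths, as a
  choice of one fibre point for every time subject to conditions on pairs of times.

  For BDD maps the two halves of the Lipschitz quotient property are not symmetric. The fibre
  condition uses paths in \<open>Y\<close>, obtained from bounded turning by refining chains, since
  \<open>Y\<close> is doubling. The Lipschitz bound uses paths in \<open>X\<close>, but doubling of
  \<open>X\<close> is deduced only from that bound. So local path connectedness of \<open>X\<close>
  is first obtained by lifting paths of \<open>Y\<close>, and continua in \<open>X\<close> are then
  thickened to open sets.\<close>

lemma finite_selection:
  fixes A :: "'i \<Rightarrow> 'v set" and R :: "'i \<Rightarrow> 'i \<Rightarrow> 'v \<Rightarrow> 'v \<Rightarrow> bool"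
  assumes fin: "\<And>i. i \<in> I \<Longrightarrow> finite (A i)"
    and loc: "\<And>J. finite J \<Longrightarrow> J \<subseteq> I \<Longrightarrow>
      \<exists>c. (\<forall>i\<in>J. c i \<in> A i) \<and> (\<forall>i\<in>J. \<forall>j\<in>J. R i j (c i) (c j))"
  shows "\<exists>c. (\<forall>i\<in>I. c i \<in> A i) \<and> (\<forall>i\<in>I. \<forall>j\<in>I. R i j (c i) (c j))"
proof -
  \<comment> \<open>Choices form a product of finite discrete spaces, compact by Tychonoff. A
    condition \<open>R i j\<close> depends on two coordinates, so it defines a closed set, and
    \<open>loc\<close> supplies the finite intersection property.\<close>
  define X where "X = product_topology (\<lambda>i. discrete_topology (A i)) I"
  have top: "topspace X = Pi\<^sub>E I A"
    by (simp add: X_def)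
  have "compact_space (discrete_topology (A i))" if "i \<in> I" for i
    using fin[OF that] by (simp add: compact_space_discrete_topology)
  then have "compact_space X"
    by (simp add: X_def compact_space_product_topology)
  define S where "S = (\<lambda>(i, j). {c \<in> Pi\<^sub>E I A. R i j (c i) (c j)})"
  have single: "closedin X {c \<in> Pi\<^sub>E I A. c i = a}" if "i \<in> I" for i a
  proof -
    have "continuous_map X (discrete_topology (A i)) (\<lambda>c. c i)"
      unfolding X_def using continuous_map_product_projection[OF that] .
    then have "closedin X {c \<in> topspace X. c i \<in> A i \<inter> {a}}"
      by (rule closedin_continuous_map_preimage) simp
    then show ?thesis
      by (rule back_subst[of "closedin X"]) (use that in \<open>auto simp: top\<close>)
  qed
  have closedS: "closedin X (S ij)" if "ij \<in> I \<times> I" for ij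
  proof -
    from that obtain i j where ij: "ij = (i, j)" "i \<in> I" "j \<in> I"
      by auto
    define Q where "Q = {(a, b). a \<in> A i \<and> b \<in> A j \<and> R i j a b}"
    have "finite Q"
      by (rule finite_subset[of _ "A i \<times> A j"]) (use ij fin in \<open>auto simp: Q_def\<close>)
    then have "closedin X (\<Union>(a, b)\<in>Q. {c \<in> Pi\<^sub>E I A. c i = a} \<inter> {c \<in> Pi\<^sub>E I A. c j = b})"
      using ij single by (intro closedin_Union) (auto intro!: closedin_Int)
    then show ?thesis
      by (rule back_subst[of "closedin X"]) (use ij in \<open>auto simp: Q_def S_def\<close>)
  qed
  have fip: "\<Inter>F \<noteq> {}" if F: "finite F" "F \<subseteq> insert (Pi\<^sub>E I A) (S ` (I \<times> I))" for F
  proof -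
    have "finite (F - {Pi\<^sub>E I A})" "F - {Pi\<^sub>E I A} \<subseteq> S ` (I \<times> I)"
      using F by auto
    then obtain G where G: "G \<subseteq> I \<times> I" "finite G" "F - {Pi\<^sub>E I A} = S ` G"
      by (meson finite_subset_image)
    define J where "J = fst ` G \<union> snd ` G"
    have J: "finite J" "J \<subseteq> I"
      using G by (auto simp: J_def)
    from loc[OF this] obtain c where
      c: "\<And>i. i \<in> J \<Longrightarrow> c i \<in> A i" "\<And>i j. i \<in> J \<Longrightarrow> j \<in> J \<Longrightarrow> R i j (c i) (c j)"
      by blast
    have "A i \<noteq> {}" if "i \<in> I" for i
      using loc[of "{i}"] that by auto
    then have "\<forall>i\<in>I. \<exists>a. a \<in> A i" by blast
    then obtain d where d: "\<And>i. i \<in> I \<Longrightarrow> d i \<in> A i"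
      by (auto dest!: bchoice)
    \<comment> \<open>\<open>F\<close> constrains only coordinates in \<open>J\<close>; elsewhere
      any admissible value completes the choice.\<close>
    define e where "e = restrict (\<lambda>i. if i \<in> J then c i else d i) I"
    have e: "e \<in> Pi\<^sub>E I A"
      unfolding e_def using c(1) d by (intro restrict_PiE_iff[THEN iffD2]) simp
    have "e \<in> S ij" if "ij \<in> G" for ij
    proof -
      obtain i j where ij: "ij = (i, j)" by fastforce
      then have "i \<in> J" "j \<in> J"
        using that by (force simp: J_def)+
      then show ?thesis
        using e c(2)[of i j] J ij by (simp add: S_def e_def subset_iff)
    qed
    then have "e \<in> \<Inter>F"
      using e G(3) by blast
    then show ?thesis by blast
  qed
  have "closedin X (Pi\<^sub>E I A)"
    by (metis closedin_topspace top)
  then have "\<forall>C\<in>insert (Pi\<^sub>E I A) (S ` (I \<times> I)). closedin X C"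
    using closedS by auto
  moreover have "\<forall>F. finite F \<and> F \<subseteq> insert (Pi\<^sub>E I A) (S ` (I \<times> I)) \<longrightarrow> \<Inter>F \<noteq> {}"
    using fip by simp
  ultimately have "\<Inter>(insert (Pi\<^sub>E I A) (S ` (I \<times> I))) \<noteq> {}"
    by (intro \<open>compact_space X\<close>[unfolded compact_space_fip, THEN spec, THEN mp] conjI)
  then obtain c where "c \<in> Pi\<^sub>E I A" "\<And>i j. i \<in> I \<Longrightarrow> j \<in> I \<Longrightarrow> c \<in> S (i, j)"
    by auto
  then show ?thesis
    by (intro exI[of _ c]) (auto simp: S_def)
qed

section \<open>Separated nets and doubling metric spaces\<close>

lemma maximal_separated_subset:
  fixes S :: "'a::metric_space set"
  assumes "r > 0"
  obtains P where "P \<subseteq> S" "pairwise (\<lambda>x y. r \<le> dist x y) P" "\<And>z. z \<in> S \<Longrightarrow> \<exists>p\<in>P. dist z p < r"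
proof -
  define F where "F = {P. P \<subseteq> S \<and> pairwise (\<lambda>x y. r \<le> dist x y) P}"
  have "\<exists>U\<in>F. \<forall>X\<in>C. X \<subseteq> U" if "subset.chain F C" for C
  proof -
    have "\<Union>C \<in> F"
      using that pairwise_chain_Union[of C "\<lambda>x y. r \<le> dist x y"]
      unfolding F_def subset_chain_def chain_subset_def by blast
    then show ?thesis by blast
  qed
  from subset_Zorn[OF this] obtain P where P: "P \<in> F" "\<And>X. X \<in> F \<Longrightarrow> P \<subseteq> X \<Longrightarrow> X = P"
    by auto
  have "\<exists>p\<in>P. dist z p < r" if "z \<in> S" for z
  proof (rule ccontr)
    assume *: "\<not> ?thesis"
    then have "insert z P \<in> F"
      using P(1) that by (auto simp: F_def pairwise_insert dist_commute not_less)
    then have "z \<in> P" using P(2)[of "insert z P"] by blast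
    then show False using * \<open>r > 0\<close> by force
  qed
  with P(1) show thesis
    by (intro that[of P]) (auto simp: F_def)
qed

text \<open>Packing form of the doubling condition, uniform in the scale \<open>r\<close>. Admitting
  every ratio \<open>K\<close> at once saves iterating a condition for a single ratio.\<close>

definition doubling :: "'a::metric_space set \<Rightarrow> bool" where
  "doubling S \<longleftrightarrow> (\<forall>K. \<exists>M::nat. \<forall>r>0. \<forall>P\<subseteq>S.
    pairwise (\<lambda>x y. r \<le> dist x y) P \<longrightarrow> (\<forall>x\<in>P. \<forall>y\<in>P. dist x y \<le> K * r) \<longrightarrow>
    finite P \<and> card P \<le> M)"

lemma doublingE:
  assumes "doubling S"
  obtains M :: nat where "\<And>r P. r > 0 \<Longrightarrow> P \<subseteq> S \<Longrightarrow> pairwise (\<lambda>x y. r \<le> dist x y) P \<Longrightarrow>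
    (\<And>x y. x \<in> P \<Longrightarrow> y \<in> P \<Longrightarrow> dist x y \<le> K * r) \<Longrightarrow> finite P \<and> card P \<le> M"
proof -
  obtain M :: nat where "\<forall>r>0. \<forall>P\<subseteq>S.
    pairwise (\<lambda>x y. r \<le> dist x y) P \<longrightarrow> (\<forall>x\<in>P. \<forall>y\<in>P. dist x y \<le> K * r) \<longrightarrow>
    finite P \<and> card P \<le> M"
    using spec[OF assms[unfolded doubling_def], of K] by (elim exE)
  then show thesis
    by (intro that[of M]) simp
qed

lemma bilipschitz_embeds_EuclideanE:
  assumes "bilipschitz_embeds_Euclidean S"
  obtains m :: nat and h :: "'a::metric_space \<Rightarrow> nat \<Rightarrow> real" and L :: real where "L \<ge> 1"
    "\<And>x y. x \<in> S \<Longrightarrow> y \<in> S \<Longrightarrow> inverse L * dist x y \<le> L2_set (\<lambda>i. h x i - h y i) {..<m}"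
    "\<And>x y. x \<in> S \<Longrightarrow> y \<in> S \<Longrightarrow> L2_set (\<lambda>i. h x i - h y i) {..<m} \<le> L * dist x y"
  using assms unfolding bilipschitz_embeds_Euclidean_def by (elim exE conjE) (rule that, auto)

text \<open>Pigeonhole principle: rounding the coordinates of \<open>h\<close>, taken relative to a
  base point, to a grid is injective on an \<open>r\<close>-separated set, and the number of cells
  available depends only on \<open>K\<close>, \<open>L\<close> and \<open>m\<close>.\<close>

lemma bilipschitz_embeds_Euclidean_imp_doubling:
  assumes "bilipschitz_embeds_Euclidean S"
  shows "doubling S"
  unfolding doubling_def
proof
  fix K :: real
  obtain m :: nat and h :: "'a \<Rightarrow> nat \<Rightarrow> real" and L :: real where L: "L \<ge> 1"
    and lo: "\<And>x y. x \<in> S \<Longrightarrow> y \<in> S \<Longrightarrow> inverse L * dist x y \<le> L2_set (\<lambda>i. h x i - h y i) {..<m}"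
    and up: "\<And>x y. x \<in> S \<Longrightarrow> y \<in> S \<Longrightarrow> L2_set (\<lambda>i. h x i - h y i) {..<m} \<le> L * dist x y"
    by (rule bilipschitz_embeds_EuclideanE[OF assms]) (rule that)
  define B where "B = \<lceil>L * K * (L * (real m + 1))\<rceil> + 1"
  define T where "T = PiE {..<m} (\<lambda>_. {-B..B})"
  have finT: "finite T"
    unfolding T_def by (intro finite_PiE) auto
  have "finite P \<and> card P \<le> card T"
    if r: "r > 0" and PS: "P \<subseteq> S" and sep: "pairwise (\<lambda>x y. r \<le> dist x y) P"
      and dia: "\<forall>x\<in>P. \<forall>y\<in>P. dist x y \<le> K * r" for r P
  proof (cases "P = {}")
    case False
    then obtain o' where o: "o' \<in> P" by blast
    \<comment> \<open>With \<open>m + 1\<close> in place of \<open>m\<close>, points of one cell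
      have images at distance at most \<open>m * d\<close>, strictly less than \<open>r / L\<close>.
      This also covers \<open>m = 0\<close>.\<close>
    define d where "d = r / (L * (real m + 1))"
    have d: "d > 0" using r L by (auto simp: d_def)
    define q where "q x = restrict (\<lambda>i. \<lfloor>(h x i - h o' i) / d\<rfloor>) {..<m}" for x
    have inT: "q x \<in> T" if x: "x \<in> P" for x
    proof -
      have "\<lfloor>(h x i - h o' i) / d\<rfloor> \<in> {-B..B}" if "i < m" for i
      proof -
        have "\<bar>h x i - h o' i\<bar> \<le> L2_set (\<lambda>i. h x i - h o' i) {..<m}"
          using member_le_L2_set[of "{..<m}" i "\<lambda>i. \<bar>h x i - h o' i\<bar>"] that
          by (simp add: L2_set_def)
        also have "\<dots> \<le> L * (K * r)"
          using up[of x o'] dia x o PS L by (meson mult_left_mono order_trans subsetD zero_le_one)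
        finally have "\<bar>(h x i - h o' i) / d\<bar> \<le> L * (K * r) / d"
          using d by (simp add: divide_right_mono)
        also have "L * (K * r) / d = L * K * (L * (real m + 1))"
          using r L by (simp add: d_def)
        finally have "\<bar>(h x i - h o' i) / d\<bar> \<le> L * K * (L * (real m + 1))" .
        then show ?thesis
          unfolding B_def atLeastAtMost_iff by linarith
      qed
      then show ?thesis
        unfolding T_def q_def by (intro restrict_PiE_iff[THEN iffD2]) simp
    qed
    have "inj_on q P"
    proof (rule inj_onI, rule ccontr)
      fix x y assume xy: "x \<in> P" "y \<in> P" "q x = q y" "x \<noteq> y"
      have "\<bar>h x i - h y i\<bar> \<le> d" if "i < m" for i
      proof -
        have "\<lfloor>(h x i - h o' i) / d\<rfloor> = \<lfloor>(h y i - h o' i) / d\<rfloor>"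
          using fun_cong[OF xy(3), of i] that by (simp add: q_def)
        then have "\<bar>(h x i - h o' i) / d - (h y i - h o' i) / d\<bar> \<le> 1"
          by linarith
        then have "\<bar>(h x i - h y i) / d\<bar> \<le> 1"
          by (simp add: diff_divide_distrib)
        then show ?thesis using d by (simp add: field_simps)
      qed
      then have "(\<Sum>i<m. \<bar>h x i - h y i\<bar>) \<le> (\<Sum>i<m. d)"
        by (intro sum_mono) auto
      then have "L2_set (\<lambda>i. h x i - h y i) {..<m} \<le> real m * d"
        using L2_set_le_sum_abs[of "\<lambda>i. h x i - h y i" "{..<m}"] by simp
      moreover have "r \<le> dist x y"
        using sep xy by (auto simp: pairwise_def)
      then have "inverse L * r \<le> inverse L * dist x y"
        using L by (intro mult_left_mono) auto
      moreover have "inverse L * dist x y \<le> L2_set (\<lambda>i. h x i - h y i) {..<m}"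
        using lo xy PS by blast
      moreover have "(real m + 1) * d = ((real m + 1) * r) / ((real m + 1) * L)"
        by (simp add: d_def mult.commute)
      then have "inverse L * r = (real m + 1) * d"
        by (simp add: divide_inverse mult.commute add_nonneg_eq_0_iff)
      ultimately show False
        using d by (simp add: algebra_simps)
    qed
    then show ?thesis
      using inT finT by (meson card_inj_on_le image_subsetI inj_on_finite)
  qed simp
  then show "\<exists>M::nat. \<forall>r>0. \<forall>P\<subseteq>S.
    pairwise (\<lambda>x y. r \<le> dist x y) P \<longrightarrow> (\<forall>x\<in>P. \<forall>y\<in>P. dist x y \<le> K * r) \<longrightarrow>
    finite P \<and> card P \<le> M" by blast
qed

lemma bilipschitz_embeds_Euclidean_vec:
  "bilipschitz_embeds_Euclidean (UNIV :: (real ^ 'n) set)"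
proof -
  obtain e where e: "bij_betw e {..<CARD('n)} (UNIV :: 'n set)"
    using ex_bij_betw_nat_finite[of "UNIV :: 'n set"] by (auto simp: atLeast0LessThan)
  define h where "h = (\<lambda>(x :: real ^ 'n) i. if i < CARD('n) then x $ e i else 0)"
  have "L2_set (\<lambda>i. h x i - h y i) {..<CARD('n)} = dist x y" for x y
  proof -
    have "L2_set (\<lambda>i. h x i - h y i) {..<CARD('n)} = sqrt (\<Sum>i<CARD('n). (x $ e i - y $ e i)\<^sup>2)"
      unfolding L2_set_def h_def by simp
    also have "(\<Sum>i<CARD('n). (x $ e i - y $ e i)\<^sup>2) = (\<Sum>j\<in>UNIV. (x $ j - y $ j)\<^sup>2)"
      using sum.reindex_bij_betw[OF e, of "\<lambda>j. (x $ j - y $ j)\<^sup>2"] .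
    finally show ?thesis
      by (simp add: dist_vec_def L2_set_def dist_real_def)
  qed
  then show ?thesis
    unfolding bilipschitz_embeds_Euclidean_def
    by (intro exI[of _ "CARD('n)"] exI[of _ h] exI[of _ 1])
       (auto simp: topspace_Euclidean_space h_def)
qed

text \<open>A separated set is moved into the fibres over a net of its image. With net spacing
  \<open>r / (4 * C)\<close> the co-Lipschitz condition moves each point by at most
  \<open>r / 4\<close>, hence injectively, and the fibres contain at most \<open>N\<close> points
  for each net point.\<close>

lemma doubling_pullback:
  fixes f :: "'a::metric_space \<Rightarrow> 'b::metric_space" and \<Lambda> C :: real
  assumes Y: "doubling (UNIV :: 'b set)"
    and L: "\<And>x x'. dist (f x) (f x') \<le> \<Lambda> * dist x x'" "\<Lambda> \<ge> 0"
    and C: "\<And>x x'. \<exists>x''. f x'' = f x \<and> dist x'' x' \<le> C * dist (f x) (f x')" "C > 0"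
    and N: "\<And>y. finite (f -` {y}) \<and> card (f -` {y}) \<le> N"
  shows "doubling (UNIV :: 'a set)"
  unfolding doubling_def
proof
  fix K :: real
  obtain M :: nat where M: "\<And>r P. r > 0 \<Longrightarrow> pairwise (\<lambda>x y::'b. r \<le> dist x y) P \<Longrightarrow>
    (\<And>x y. x \<in> P \<Longrightarrow> y \<in> P \<Longrightarrow> dist x y \<le> (\<Lambda> * K * (4 * C)) * r) \<Longrightarrow> finite P \<and> card P \<le> M"
    using doublingE[OF Y, of "\<Lambda> * K * (4 * C)"] by (metis subset_UNIV)
  have "finite P \<and> card P \<le> N * M"
    if r: "r > 0" and sep: "pairwise (\<lambda>x y. r \<le> dist x y) P"
      and dia: "\<forall>x\<in>P. \<forall>y\<in>P. dist x y \<le> K * r" for r and P :: "'a set"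
  proof -
    obtain Q where Q: "Q \<subseteq> f ` P" "pairwise (\<lambda>x y. r / (4 * C) \<le> dist x y) Q"
      "\<And>z. z \<in> f ` P \<Longrightarrow> \<exists>p\<in>Q. dist z p < r / (4 * C)"
      using maximal_separated_subset[of "r / (4 * C)" "f ` P"] r C(2) by auto
    have "dist u v \<le> (\<Lambda> * K * (4 * C)) * (r / (4 * C))" if "u \<in> Q" "v \<in> Q" for u v
    proof -
      from Q(1) that obtain p q where pq: "p \<in> P" "q \<in> P" "u = f p" "v = f q"
        by blast
      have "dist u v \<le> \<Lambda> * (K * r)"
        using L(1)[of p q] dia L(2) pq by (meson mult_left_mono order_trans)
      then show ?thesis using C(2) by simp
    qed
    with M[OF _ Q(2)] r C(2) have Qfin: "finite Q" "card Q \<le> M" by auto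
    have "\<exists>p''. p'' \<in> f -` Q \<and> dist p'' p \<le> r / 4" if p: "p \<in> P" for p
    proof -
      obtain q where q: "q \<in> Q" "dist (f p) q < r / (4 * C)"
        using Q(3) p by blast
      obtain x where x: "q = f x" using q Q(1) by blast
      obtain p'' where p'': "f p'' = f x" "dist p'' p \<le> C * dist (f x) (f p)"
        using C(1) by blast
      have "C * dist (f x) (f p) \<le> C * (r / (4 * C))"
        using q x C(2) by (intro mult_left_mono) (auto simp: dist_commute)
      also have "\<dots> = r / 4" using C(2) by simp
      finally show ?thesis using p'' q x by (intro exI[of _ p'']) auto
    qed
    then obtain g where g: "\<And>p. p \<in> P \<Longrightarrow> g p \<in> f -` Q" "\<And>p. p \<in> P \<Longrightarrow> dist (g p) p \<le> r / 4"
      by metis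
    have inj: "inj_on g P"
    proof (rule inj_onI, rule ccontr)
      fix x y assume "x \<in> P" "y \<in> P" "g x = g y" "x \<noteq> y"
      moreover from this have "r \<le> dist x y"
        using sep by (auto simp: pairwise_def)
      ultimately show False
        using g(2)[of x] g(2)[of y] dist_triangle3[of x y "g x"] r by auto
    qed
    have eq: "f -` Q = (\<Union>q\<in>Q. f -` {q})" by auto
    have "finite (f -` Q)"
      unfolding eq using Qfin N by auto
    moreover have "card (f -` Q) \<le> (\<Sum>q\<in>Q. card (f -` {q}))"
      unfolding eq by (rule card_UN_le[OF Qfin(1)])
    moreover have "(\<Sum>q\<in>Q. card (f -` {q})) \<le> N * card Q"
      using sum_bounded_above[of Q "\<lambda>q. card (f -` {q})" N] N by (simp add: mult.commute)
    moreover have "N * card Q \<le> N * M" using Qfin by simp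
    ultimately show ?thesis
      using inj g(1) by (meson card_inj_on_le image_subsetI inj_on_finite order_trans)
  qed
  then show "\<exists>M::nat. \<forall>r>0. \<forall>P\<subseteq>UNIV.
    pairwise (\<lambda>x y::'a. r \<le> dist x y) P \<longrightarrow> (\<forall>x\<in>P. \<forall>y\<in>P. dist x y \<le> K * r) \<longrightarrow>
    finite P \<and> card P \<le> M" by blast
qed

section \<open>Colouring graphs of bounded degeneracy\<close>

lemma finite_degenerate_coloring:
  fixes E :: "'v \<Rightarrow> 'v \<Rightarrow> bool" and h :: "'v \<Rightarrow> int"
  assumes sym: "\<And>u v. E u v \<Longrightarrow> E v u" and irr: "\<And>v. \<not> E v v"
    and deg: "\<And>v. v \<in> V \<Longrightarrow> finite {w \<in> V. E v w \<and> h v \<le> h w} \<and> card {w \<in> V. E v w \<and> h v \<le> h w} \<le> \<Delta>"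
  shows "finite W \<Longrightarrow> W \<subseteq> V \<Longrightarrow>
    \<exists>c. (\<forall>v\<in>W. c v \<in> {..\<Delta>}) \<and> (\<forall>u\<in>W. \<forall>v\<in>W. E u v \<longrightarrow> c u \<noteq> c v)"
proof (induction "card W" arbitrary: W)
  case 0
  then show ?case by auto
next
  case (Suc n)
  then have "W \<noteq> {}" by auto
  \<comment> \<open>A vertex of least height is removed and coloured last: within \<open>W\<close>
    all its neighbours have at least its height, so at most \<Delta> of the \<Delta> + 1 colours are
    blocked.\<close>
  then obtain v where v: "v \<in> W" "\<And>w. w \<in> W \<Longrightarrow> h v \<le> h w"
    using arg_min_if_finite(1)[OF Suc.prems(1), of h] arg_min_least[OF Suc.prems(1), of _ h]
    by blast
  have "n = card (W - {v})" using Suc v by simp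
  then have "\<exists>c. (\<forall>v'\<in>W - {v}. c v' \<in> {..\<Delta>}) \<and>
      (\<forall>u\<in>W - {v}. \<forall>w\<in>W - {v}. E u w \<longrightarrow> c u \<noteq> c w)"
    using Suc.prems by (intro Suc.hyps(1)) auto
  then obtain c where
    c: "\<And>v'. v' \<in> W - {v} \<Longrightarrow> c v' \<in> {..\<Delta>}"
      "\<And>u w. u \<in> W - {v} \<Longrightarrow> w \<in> W - {v} \<Longrightarrow> E u w \<Longrightarrow> c u \<noteq> c w"
    by blast
  define Nb where "Nb = {w \<in> W. E v w}"
  have sub: "Nb \<subseteq> {w \<in> V. E v w \<and> h v \<le> h w}"
    using v Suc.prems by (auto simp: Nb_def)
  have vV: "v \<in> V" using v Suc.prems by auto
  have "card Nb \<le> \<Delta>"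
    using card_mono[OF _ sub] deg[OF vV] by linarith
  moreover have "finite Nb" using Suc.prems by (simp add: Nb_def)
  ultimately have "card (c ` Nb) < card {..\<Delta>}"
    using card_image_le[of Nb c] by simp
  then have "\<not> {..\<Delta>} \<subseteq> c ` Nb"
    using \<open>finite Nb\<close> by (meson card_mono finite_imageI not_less)
  then obtain k where k: "k \<le> \<Delta>" "k \<notin> c ` Nb" by auto
  show ?case
  proof (intro exI[of _ "c(v := k)"] conjI ballI impI)
    fix u w assume uw: "u \<in> W" "w \<in> W" "E u w"
    then consider "u = v" "w \<noteq> v" "w \<in> Nb" | "u \<noteq> v" "w = v" "u \<in> Nb" | "u \<noteq> v" "w \<noteq> v"
      using irr sym by (auto simp: Nb_def)
    then show "(c(v := k)) u \<noteq> (c(v := k)) w"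
      using k c(2)[of u w] uw by cases auto
  qed (use c(1) k in auto)
qed

text \<open>An infinite graph may have no vertex of least height to remove; compactness reduces the
  claim to finite subgraphs.\<close>

lemma degenerate_coloring:
  fixes E :: "'v \<Rightarrow> 'v \<Rightarrow> bool" and h :: "'v \<Rightarrow> int"
  assumes "\<And>u v. E u v \<Longrightarrow> E v u" "\<And>v. \<not> E v v"
    and "\<And>v. v \<in> V \<Longrightarrow> finite {w \<in> V. E v w \<and> h v \<le> h w} \<and> card {w \<in> V. E v w \<and> h v \<le> h w} \<le> \<Delta>"
  shows "\<exists>c :: 'v \<Rightarrow> nat. (\<forall>v\<in>V. c v \<le> \<Delta>) \<and> (\<forall>u\<in>V. \<forall>v\<in>V. E u v \<longrightarrow> c u \<noteq> c v)"
proof -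
  have "\<exists>c. (\<forall>v\<in>V. c v \<in> {..\<Delta>}) \<and> (\<forall>u\<in>V. \<forall>v\<in>V. E u v \<longrightarrow> c u \<noteq> c v)"
    by (rule finite_selection) (use finite_degenerate_coloring[OF assms] in simp_all)
  then show ?thesis by simp
qed

section \<open>The embedding theorem for finite-to-one Lipschitz quotients\<close>

text \<open>The Lipschitz constant stays 1 however many bumps are glued: if \<open>n\<close> is
  active at \<open>z\<close>, then \<open>G w\<close> is at least \<open>\<phi> n w\<close>, being
  equal to it or nonnegative where it vanishes, so \<open>G z - G w\<close> is at most
  \<open>\<phi> n z - \<phi> n w\<close>.\<close>

lemma glue_disjoint_bumps:
  fixes \<phi> :: "'n \<Rightarrow> 'a::metric_space \<Rightarrow> real"
  assumes nonneg: "\<And>n z. \<phi> n z \<ge> 0"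
    and lip: "\<And>n z w. \<bar>\<phi> n z - \<phi> n w\<bar> \<le> dist z w"
    and disj: "\<And>n n' z. n \<in> W \<Longrightarrow> n' \<in> W \<Longrightarrow> \<phi> n z > 0 \<Longrightarrow> \<phi> n' z > 0 \<Longrightarrow> n = n'"
  shows "\<exists>G. (\<forall>z w. \<bar>G z - G w\<bar> \<le> dist z w) \<and> (\<forall>n\<in>W. \<forall>z. \<phi> n z > 0 \<longrightarrow> G z = \<phi> n z) \<and>
    (\<forall>z. (\<forall>n\<in>W. \<phi> n z \<le> 0) \<longrightarrow> G z = 0)"
proof -
  define G where "G z = (if \<exists>n\<in>W. \<phi> n z > 0 then \<phi> (SOME n. n \<in> W \<and> \<phi> n z > 0) z else 0)" for z
  have G1: "G z = \<phi> n z" if "n \<in> W" "\<phi> n z > 0" for n z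
  proof -
    have "(SOME n. n \<in> W \<and> \<phi> n z > 0) = n"
      using that disj by (intro some_equality) auto
    then show ?thesis using that by (auto simp: G_def)
  qed
  have G0: "G z = 0" if "\<And>n. n \<in> W \<Longrightarrow> \<phi> n z \<le> 0" for z
    using that by (auto simp: G_def not_less[symmetric])
  have nn: "G z \<ge> 0" for z
    using nonneg by (auto simp: G_def)
  have half: "G z - G w \<le> dist z w" for z w
  proof (cases "\<exists>n\<in>W. \<phi> n z > 0")
    case True
    then obtain n where n: "n \<in> W" "\<phi> n z > 0" by blast
    show ?thesis
    proof (cases "\<phi> n w > 0")
      case True
      then show ?thesis using n lip[of n z w] G1[of n] by auto
    next
      case False
      then have "\<phi> n w = 0" using nonneg[of n w] by simp
      then show ?thesis using G1[OF n] nn[of w] lip[of n z w] by simp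
    qed
  next
    case False
    then have "G z = 0" by (auto intro: G0 simp: not_less)
    then show ?thesis using nn[of w] by (smt (verit) zero_le_dist)
  qed
  have "\<bar>G z - G w\<bar> \<le> dist z w" for z w
    using half[of z w] half[of w z] by (simp add: dist_commute abs_le_iff)
  with G1 G0 show ?thesis by blast
qed

section \<open>Dyadic scales\<close>

definition dyadic :: "int \<Rightarrow> real" where
  "dyadic k = 2 powr real_of_int k"

lemma dyadic_pos [simp]: "dyadic k > 0"
  by (simp add: dyadic_def)

lemma dyadic_nonneg [simp]: "dyadic k \<ge> 0"
  by (simp add: dyadic_def)

lemma dyadic_add: "dyadic (j + k) = dyadic j * dyadic k"
  by (simp add: dyadic_def powr_add)

lemma dyadic_Suc [simp]: "dyadic (k + 1) = 2 * dyadic k"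
  by (simp add: dyadic_def powr_add)

lemma dyadic_less_iff [simp]: "dyadic j < dyadic k \<longleftrightarrow> j < k"
  by (simp add: dyadic_def)

lemma dyadic_le_iff [simp]: "dyadic j \<le> dyadic k \<longleftrightarrow> j \<le> k"
  by (simp add: dyadic_def)

lemma dyadic_nat: "dyadic (int n) = 2 ^ n"
  by (simp add: dyadic_def powr_realpow)

lemma exists_scale:
  assumes "r > 0"
  obtains k where "dyadic k \<le> r" "r < 2 * dyadic k"
  using assms floor_log_eq_powr_iff[of r 2 "\<lfloor>log 2 r\<rfloor>"]
  by (auto simp: dyadic_def powr_add)

text \<open>If \<open>j\<close> is the scale of \<open>d\<close>, the exponents lie in
  \<open>{j - 2..j + 1}\<close>. The case \<open>d = 0\<close>, in which no scale qualifies, occurs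
  later when a point is compared with itself as a member of its fibre.\<close>

lemma card_comparable_scales:
  "finite {k. dyadic k \<le> 2 * d \<and> d \<le> 4 * dyadic k} \<and> card {k. dyadic k \<le> 2 * d \<and> d \<le> 4 * dyadic k} \<le> 4"
proof (cases "d > 0")
  case True
  then obtain j where j: "dyadic j \<le> d" "d < 2 * dyadic j"
    by (rule exists_scale)
  have "{k. dyadic k \<le> 2 * d \<and> d \<le> 4 * dyadic k} \<subseteq> {j - 2..j + 1}"
  proof (rule subsetI, drule CollectD)
    fix k assume k: "dyadic k \<le> 2 * d \<and> d \<le> 4 * dyadic k"
    have "dyadic k < dyadic (j + 2)"
      using k j by (simp add: dyadic_add dyadic_nat[of 2, simplified])
    moreover have "dyadic j \<le> dyadic (k + 2)"
      using k j by (simp add: dyadic_add dyadic_nat[of 2, simplified])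
    ultimately show "k \<in> {j - 2..j + 1}" by simp
  qed
  then show ?thesis
    using card_mono[of "{j - 2..j + 1}"] finite_subset[of _ "{j - 2..j + 1}"] by fastforce
next
  case False
  then have "{k. dyadic k \<le> 2 * d \<and> d \<le> 4 * dyadic k} = {}"
    using dyadic_pos by (auto simp: not_le) (smt (verit) dyadic_pos)
  then show ?thesis by (metis card.empty finite.emptyI zero_le)
qed

lemma card_Sigma_le:
  assumes "finite A" "card A \<le> a" "\<And>x. x \<in> A \<Longrightarrow> finite (B x) \<and> card (B x) \<le> b"
    and "S \<subseteq> Sigma A B"
  shows "finite S \<and> card S \<le> a * b"
proof -
  have fin: "finite (Sigma A B)" using assms by auto
  have "card S \<le> card (Sigma A B)" using fin assms(4) by (rule card_mono)
  also have "\<dots> = (\<Sum>x\<in>A. card (B x))"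
    using assms by (intro card_SigmaI) auto
  also have "\<dots> \<le> card A * b"
    using sum_bounded_above[of A "\<lambda>x. card (B x)" b] assms(3) by simp
  also have "\<dots> \<le> a * b" using assms(2) by simp
  finally show ?thesis using fin assms(4) finite_subset by blast
qed

text \<open>A point of \<open>ramified_at f \<epsilon> k\<close> has, at distance about \<open>dyadic k\<close>, a point with almost the same
  image. Since the fibres have boundedly many points and \<open>f\<close> is co-Lipschitz, a point is close
  to ramified points of boundedly many scales only.\<close>

definition ramified_at :: "('a::metric_space \<Rightarrow> 'b::metric_space) \<Rightarrow> real \<Rightarrow> int \<Rightarrow> 'a set" where
  "ramified_at f \<epsilon> k =
    {x. \<exists>p. dyadic k \<le> dist x p \<and> dist x p < 2 * dyadic k \<and> dist (f x) (f p) \<le> \<epsilon> * dyadic k}"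

text \<open>The conflicts that the colouring resolves. Bumps will have radius
  \<open>2 * \<eta>\<close> times their scale, so overlapping bumps are close. So is a bump of scale
  at least \<open>k - 1\<close> met at a point \<open>y\<close> that a bump of scale
  \<open>k\<close> has to separate from some \<open>x\<close>: the centres are then at distance at
  most \<open>4 * dyadic k\<close> plus one radius, and the factor 8 allows for the other scale
  being \<open>k - 1\<close>. The larger scale enters only with the small factor \<eta>, which keeps
  conflicts with large scales few.\<close>

definition close_nodes :: "real \<Rightarrow> 'a::metric_space \<times> int \<Rightarrow> 'a \<times> int \<Rightarrow> bool" where
  "close_nodes \<eta> n n' \<longleftrightarrow> n \<noteq> n' \<and>
    dist (fst n) (fst n') \<le> 8 * min (dyadic (snd n)) (dyadic (snd n')) +
      2 * \<eta> * max (dyadic (snd n)) (dyadic (snd n'))"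

lemma close_nodes_sym: "close_nodes \<eta> n n' \<Longrightarrow> close_nodes \<eta> n' n"
  by (auto simp: close_nodes_def dist_commute min.commute max.commute)

text \<open>Doubling bounds the nodes of each scale, so it remains to count scales. If the scale of
  a conflicting node \<open>x'\<close> is far above that of \<open>x\<close>, then \<open>x\<close>
  is so near \<open>x'\<close> relative to that scale that the partner \<open>p\<close> of
  \<open>x'\<close> can be replaced by a point of the fibre of \<open>f x\<close> at comparable
  distance from \<open>x\<close>. Each of the at most \<open>N\<close> fibre points accounts for at
  most four scales.\<close>

lemma card_close_nodes:
  fixes f :: "'a::metric_space \<Rightarrow> 'b::metric_space" and \<Lambda> C :: real
  assumes X: "doubling (UNIV :: 'a set)"
    and L: "\<And>x x'. dist (f x) (f x') \<le> \<Lambda> * dist x x'" "\<Lambda> \<ge> 1"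
    and C: "\<And>x x'. \<exists>x''. f x'' = f x \<and> dist x'' x' \<le> C * dist (f x) (f x')" "C \<ge> 1"
    and N: "\<And>y. finite (f -` {y}) \<and> card (f -` {y}) \<le> N"
    and \<epsilon>: "\<epsilon> = 1 / (8 * C)" and \<eta>: "\<eta> = 1 / (24 * \<Lambda> * C)"
  shows "\<exists>\<Delta>. \<forall>(P :: int \<Rightarrow> 'a set) n. (\<forall>k. P k \<subseteq> ramified_at f \<epsilon> k) \<longrightarrow>
    (\<forall>k. pairwise (\<lambda>x y. \<eta> * dyadic k \<le> dist x y) (P k)) \<longrightarrow>
    finite {n'. fst n' \<in> P (snd n') \<and> close_nodes \<eta> n n' \<and> snd n \<le> snd n'} \<and>
    card {n'. fst n' \<in> P (snd n') \<and> close_nodes \<eta> n n' \<and> snd n \<le> snd n'} \<le> \<Delta>"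
proof -
  have \<eta>0: "\<eta> > 0" using L C by (simp add: \<eta>)
  have LC: "\<Lambda> * C \<ge> 1" using L(2) C(2) by (metis mult_mono mult_1 zero_le_one order_trans)
  have \<eta>1: "3 * \<eta> \<le> 1 / 8"
    using LC by (simp add: \<eta> field_simps)
  \<comment> \<open>By the choice of \<epsilon> and \<eta>, the two errors, one from passing from
    \<open>x'\<close> to \<open>x\<close> and one from the distance between \<open>f x'\<close> and
    \<open>f p\<close>, each contribute 1/8.\<close>
  have const: "C * (\<Lambda> * (3 * \<eta>) + \<epsilon>) = 1 / 4"
    using L(2) C(2) by (simp add: \<eta> \<epsilon> field_simps)
  \<comment> \<open>Beyond \<open>J\<close> further scales the term \<open>8 * dyadic k\<close> of
    \<open>close_nodes\<close> is at most \<open>\<eta> * dyadic k'\<close>, which leaves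
    \<open>dist x x' \<le> 3 * \<eta> * dyadic k'\<close>.\<close>
  obtain J :: nat where J: "2 ^ J \<ge> 8 / \<eta>"
    using real_arch_pow[of 2 "8 / \<eta>"] by (auto intro: less_imp_le)
  obtain M :: nat where M: "\<And>r P. r > 0 \<Longrightarrow> pairwise (\<lambda>x y::'a. r \<le> dist x y) P \<Longrightarrow>
    (\<And>x y. x \<in> P \<Longrightarrow> y \<in> P \<Longrightarrow> dist x y \<le> (18 / \<eta>) * r) \<Longrightarrow> finite P \<and> card P \<le> M"
    using doublingE[OF X, of "18 / \<eta>"] by (metis subset_UNIV)
  have "finite B \<and> card B \<le> (J + 1 + 4 * N) * M"
    if B: "B = {n'. fst n' \<in> P (snd n') \<and> close_nodes \<eta> n n' \<and> snd n \<le> snd n'}"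
      and PA: "\<And>k. P k \<subseteq> ramified_at f \<epsilon> k"
      and sep: "\<And>k. pairwise (\<lambda>x y. \<eta> * dyadic k \<le> dist x y) (P k)"
    for P :: "int \<Rightarrow> 'a set" and n B
  proof -
    obtain x k where n: "n = (x, k)" by fastforce
    define near where "near p = {k'. dyadic k' \<le> 2 * dist x p \<and> dist x p \<le> 4 * dyadic k'}" for p
    define Ks where "Ks = {k..k + int J} \<union> (\<Union>p\<in>f -` {f x}. near p)"
    have near: "finite (near p) \<and> card (near p) \<le> 4" for p
      unfolding near_def by (rule card_comparable_scales)
    have finKs: "finite Ks"
      using near N by (auto simp: Ks_def)
    have "card (\<Union>p\<in>f -` {f x}. near p) \<le> (\<Sum>p\<in>f -` {f x}. card (near p))"
      by (rule card_UN_le) (use N in auto)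
    also have "\<dots> \<le> 4 * card (f -` {f x})"
      using sum_bounded_above[of "f -` {f x}" "\<lambda>p. card (near p)" 4] near by (simp add: mult.commute)
    also have "\<dots> \<le> 4 * N" using N by simp
    finally have cardKs: "card Ks \<le> J + 1 + 4 * N"
      using card_Un_le[of "{k..k + int J}" "\<Union>p\<in>f -` {f x}. near p"] by (simp add: Ks_def)
    define T where "T k' = P k' \<inter> cball x (9 * dyadic k')" for k'
    have T: "finite (T k') \<and> card (T k') \<le> M" for k'
    proof (rule M)
      show "0 < \<eta> * dyadic k'" using \<eta>0 by simp
      show "pairwise (\<lambda>x y. \<eta> * dyadic k' \<le> dist x y) (T k')"
        using sep[of k'] by (rule pairwise_subset) (auto simp: T_def)
      fix u v assume "u \<in> T k'" "v \<in> T k'"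
      then have "dist u v \<le> 18 * dyadic k'"
        using dist_triangle3[of u v x] by (auto simp: T_def)
      then show "dist u v \<le> 18 / \<eta> * (\<eta> * dyadic k')"
        using \<eta>0 by simp
    qed
    have "B \<subseteq> (\<lambda>(k', x'). (x', k')) ` Sigma Ks T"
    proof
      fix n' assume n': "n' \<in> B"
      obtain x' k' where x': "n' = (x', k')" by fastforce
      have P: "x' \<in> P k'" and kk: "k \<le> k'"
        using n' by (auto simp: x' n B)
      have close: "dist x x' \<le> 8 * dyadic k + 2 * \<eta> * dyadic k'"
        using n' kk by (auto simp: x' n B close_nodes_def min_def max_def)
      have "2 * \<eta> * dyadic k' \<le> 1 * dyadic k'"
        by (intro mult_right_mono) (use \<eta>1 \<eta>0 in auto)
      moreover have "dyadic k \<le> dyadic k'" using kk by simp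
      ultimately have "dist x x' \<le> 9 * dyadic k'" using close by linarith
      then have "x' \<in> T k'" using P by (simp add: T_def)
      moreover have "k' \<in> Ks"
      proof (cases "k' \<le> k + int J")
        case True
        then show ?thesis using kk by (simp add: Ks_def)
      next
        case False
        have "8 * dyadic k \<le> \<eta> * (dyadic (int J) * dyadic k)"
          using J \<eta>0 by (simp add: dyadic_nat field_simps)
        also have "\<dots> \<le> \<eta> * dyadic k'"
          using False \<eta>0 by (simp add: dyadic_add[symmetric])
        finally have d: "dist x x' \<le> 3 * \<eta> * dyadic k'" using close by simp
        obtain p where p: "dyadic k' \<le> dist x' p" "dist x' p < 2 * dyadic k'"
          "dist (f x') (f p) \<le> \<epsilon> * dyadic k'"
          using PA P unfolding ramified_at_def by blast
        obtain p'' where p'': "f p'' = f x" "dist p'' p \<le> C * dist (f x) (f p)"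
          using C(1) by blast
        have "dist (f x) (f p) \<le> dist (f x) (f x') + dist (f x') (f p)"
          by (rule dist_triangle)
        also have "\<dots> \<le> \<Lambda> * (3 * \<eta> * dyadic k') + \<epsilon> * dyadic k'"
          using L(1)[of x x'] p(3) mult_left_mono[OF d, of \<Lambda>] L(2) by linarith
        finally have "C * dist (f x) (f p) \<le> C * (\<Lambda> * (3 * \<eta> * dyadic k') + \<epsilon> * dyadic k')"
          using C(2) by (intro mult_left_mono) auto
        also have "\<dots> = C * (\<Lambda> * (3 * \<eta>) + \<epsilon>) * dyadic k'"
          by (simp add: algebra_simps)
        finally have "dist p'' p \<le> dyadic k' / 4"
          using p''(2) const by simp
        moreover have "3 * \<eta> * dyadic k' \<le> 1 / 8 * dyadic k'"
          using \<eta>1 by (intro mult_right_mono) auto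
        moreover have "dist x' p \<le> dist x x' + dist x p'' + dist p'' p"
          using dist_triangle3[of x' p x] dist_triangle[of x p p''] by linarith
        moreover have "dist x p'' \<le> dist x x' + dist x' p + dist p'' p"
          using dist_triangle[of x p'' x'] dist_triangle[of x' p'' p] by (simp add: dist_commute)
        \<comment> \<open>\<open>dist x' p\<close> is between \<open>dyadic k'\<close> and twice
          that, and replacing both endpoints costs at most 3/8 of \<open>dyadic k'\<close>.\<close>
        ultimately have "dyadic k' \<le> 2 * dist x p''" "dist x p'' \<le> 4 * dyadic k'"
          using d p dyadic_pos[of k'] by linarith+
        then show ?thesis
          using p''(1) by (auto simp: Ks_def near_def)
      qed
      ultimately show "n' \<in> (\<lambda>(k', x'). (x', k')) ` Sigma Ks T"
        by (force simp: x')
    qed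
    moreover have "finite (Sigma Ks T) \<and> card (Sigma Ks T) \<le> (J + 1 + 4 * N) * M"
      using finKs cardKs T by (rule card_Sigma_le[OF _ _ _ subset_refl])
    ultimately show ?thesis
      by (meson card_image_le card_mono finite_imageI finite_subset order_trans)
  qed
  then show ?thesis
    by (intro exI[of _ "(J + 1 + 4 * N) * M"] allI impI) simp
qed

theorem bilipschitz_embeds_Euclidean_pullback:
  fixes f :: "'a::metric_space \<Rightarrow> 'b::metric_space" and \<Lambda> C :: real
  assumes Y: "bilipschitz_embeds_Euclidean (UNIV :: 'b set)"
    and L: "\<And>x x'. dist (f x) (f x') \<le> \<Lambda> * dist x x'" "\<Lambda> \<ge> 1"
    and C: "\<And>x x'. \<exists>x''. f x'' = f x \<and> dist x'' x' \<le> C * dist (f x) (f x')" "C \<ge> 1"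
    and N: "\<And>y. finite (f -` {y}) \<and> card (f -` {y}) \<le> N"
  shows "bilipschitz_embeds_Euclidean (UNIV :: 'a set)"
proof -
  obtain m :: nat and h :: "'b \<Rightarrow> nat \<Rightarrow> real" and L0 :: real where h: "L0 \<ge> 1"
    "\<And>u v. inverse L0 * dist u v \<le> L2_set (\<lambda>i. h u i - h v i) {..<m}"
    "\<And>u v. L2_set (\<lambda>i. h u i - h v i) {..<m} \<le> L0 * dist u v"
    by (rule bilipschitz_embeds_EuclideanE[OF Y, simplified]) (rule that)
  have X: "doubling (UNIV :: 'a set)"
    by (rule doubling_pullback[where f = f and \<Lambda> = \<Lambda> and C = C and N = N])
       (use bilipschitz_embeds_Euclidean_imp_doubling[OF Y] L C N in auto)
  define \<epsilon> where "\<epsilon> = 1 / (8 * C)"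
  define \<eta> where "\<eta> = 1 / (24 * \<Lambda> * C)"
  have \<epsilon>0: "\<epsilon> > 0" and \<eta>0: "\<eta> > 0"
    using L(2) C(2) by (simp_all add: \<epsilon>_def \<eta>_def)
  have "\<Lambda> * C \<ge> 1"
    using mult_mono[of 1 \<Lambda> 1 C] L(2) C(2) by simp
  then have \<eta>1: "24 * \<eta> \<le> 1"
    by (simp add: \<eta>_def field_simps)
  obtain \<Delta> where \<Delta>: "\<forall>(P :: int \<Rightarrow> 'a set) n. (\<forall>k. P k \<subseteq> ramified_at f \<epsilon> k) \<longrightarrow>
    (\<forall>k. pairwise (\<lambda>x y. \<eta> * dyadic k \<le> dist x y) (P k)) \<longrightarrow>
    finite {n'. fst n' \<in> P (snd n') \<and> close_nodes \<eta> n n' \<and> snd n \<le> snd n'} \<and>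
    card {n'. fst n' \<in> P (snd n') \<and> close_nodes \<eta> n n' \<and> snd n \<le> snd n'} \<le> \<Delta>"
    using card_close_nodes[OF X L C N \<epsilon>_def \<eta>_def] by (elim exE)
  have "\<exists>P\<subseteq>ramified_at f \<epsilon> k. pairwise (\<lambda>x y. \<eta> * dyadic k \<le> dist x y) P \<and>
      (\<forall>z\<in>ramified_at f \<epsilon> k. \<exists>p\<in>P. dist z p < \<eta> * dyadic k)" for k
  proof -
    have "\<eta> * dyadic k > 0" using \<eta>0 by simp
    then obtain P where "P \<subseteq> ramified_at f \<epsilon> k" "pairwise (\<lambda>x y. \<eta> * dyadic k \<le> dist x y) P"
      "\<And>z. z \<in> ramified_at f \<epsilon> k \<Longrightarrow> \<exists>p\<in>P. dist z p < \<eta> * dyadic k"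
      by (rule maximal_separated_subset) (rule that)
    then show ?thesis by (intro exI[of _ P]) simp
  qed
  then obtain P where P: "\<And>k. P k \<subseteq> ramified_at f \<epsilon> k"
    "\<And>k. pairwise (\<lambda>x y. \<eta> * dyadic k \<le> dist x y) (P k)"
    "\<And>k z. z \<in> ramified_at f \<epsilon> k \<Longrightarrow> \<exists>p\<in>P k. dist z p < \<eta> * dyadic k"
    by metis
  define V where "V = {n. fst n \<in> P (snd n)}"
  have "\<exists>c. (\<forall>n\<in>V. c n \<le> \<Delta>) \<and> (\<forall>n\<in>V. \<forall>n'\<in>V. close_nodes \<eta> n n' \<longrightarrow> c n \<noteq> c n')"
  proof (rule degenerate_coloring[where h = snd])
    show "finite {w \<in> V. close_nodes \<eta> v w \<and> snd v \<le> snd w} \<and>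
      card {w \<in> V. close_nodes \<eta> v w \<and> snd v \<le> snd w} \<le> \<Delta>" for v
      using \<Delta>[rule_format, OF P(1,2), of v] by (simp add: V_def)
    show "close_nodes \<eta> v u" if "close_nodes \<eta> u v" for u v
      using that by (rule close_nodes_sym)
    show "\<not> close_nodes \<eta> v v" for v
      by (simp add: close_nodes_def)
  qed
  then obtain c where c: "\<And>n. n \<in> V \<Longrightarrow> c n \<le> \<Delta>"
    "\<And>n n'. n \<in> V \<Longrightarrow> n' \<in> V \<Longrightarrow> close_nodes \<eta> n n' \<Longrightarrow> c n \<noteq> c n'"
    by blast
  \<comment> \<open>The radius is twice the net spacing, so every point ramified at scale
    \<open>k\<close> lies in a bump of that scale whose value there exceeds
    \<open>\<eta> * dyadic k\<close>.\<close>
  define \<phi> where "\<phi> n z = max 0 (2 * \<eta> * dyadic (snd n) - dist z (fst n))" for n :: "'a \<times> int" and z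
  have nonneg: "\<phi> n z \<ge> 0" for n z by (simp add: \<phi>_def)
  have lip: "\<bar>\<phi> n z - \<phi> n w\<bar> \<le> dist z w" for n z w
    using dist_triangle[of z "fst n" w] dist_triangle[of w "fst n" z]
    by (auto simp: \<phi>_def max_def dist_commute abs_le_iff)
  have \<eta>s: "2 * \<eta> * dyadic k \<le> dyadic k / 4" for k
    using mult_right_mono[OF \<eta>1, of "dyadic k"] by simp
  have disj: "n = n'" if "n \<in> V" "n' \<in> V" "c n = c n'" "\<phi> n z > 0" "\<phi> n' z > 0" for n n' z
  proof (rule ccontr)
    assume "n \<noteq> n'"
    have "dist z (fst n) < 2 * \<eta> * dyadic (snd n)" "dist z (fst n') < 2 * \<eta> * dyadic (snd n')"
      using that(4,5) by (auto simp: \<phi>_def max_def split: if_splits)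
    then have "dist (fst n) (fst n') < 2 * \<eta> * dyadic (snd n) + 2 * \<eta> * dyadic (snd n')"
      using dist_triangle3[of "fst n" "fst n'" z] by simp
    \<comment> \<open>The smaller radius is absorbed by the \<open>min\<close> term, as \<eta> is at
      most 1/24.\<close>
    also have "\<dots> \<le> 8 * min (dyadic (snd n)) (dyadic (snd n')) +
        2 * \<eta> * max (dyadic (snd n)) (dyadic (snd n'))"
      using \<eta>s[of "snd n"] \<eta>s[of "snd n'"] dyadic_pos[of "snd n"] dyadic_pos[of "snd n'"]
      unfolding min_def max_def by (auto simp del: dyadic_pos)
    finally have "close_nodes \<eta> n n'"
      using \<open>n \<noteq> n'\<close> by (simp add: close_nodes_def)
    then show False using c(2) that by blast
  qed
  have "\<exists>G. (\<forall>z w. \<bar>G z - G w\<bar> \<le> dist z w) \<and>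
      (\<forall>n\<in>{n \<in> V. c n = i}. \<forall>z. \<phi> n z > 0 \<longrightarrow> G z = \<phi> n z) \<and>
      (\<forall>z. (\<forall>n\<in>{n \<in> V. c n = i}. \<phi> n z \<le> 0) \<longrightarrow> G z = 0)" for i
  proof (rule glue_disjoint_bumps[OF nonneg lip])
    show "n = n'" if "n \<in> {n \<in> V. c n = i}" "n' \<in> {n \<in> V. c n = i}" "0 < \<phi> n z" "0 < \<phi> n' z"
      for n n' z
      using disj[of n n' z] that by simp
  qed
  then have "\<exists>G. \<forall>i. (\<forall>z w. \<bar>G i z - G i w\<bar> \<le> dist z w) \<and>
      (\<forall>n\<in>{n \<in> V. c n = i}. \<forall>z. \<phi> n z > 0 \<longrightarrow> G i z = \<phi> n z) \<and>
      (\<forall>z. (\<forall>n\<in>{n \<in> V. c n = i}. \<phi> n z \<le> 0) \<longrightarrow> G i z = 0)"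
    by (intro choice allI)
  then obtain G where G: "\<forall>i. (\<forall>z w. \<bar>G i z - G i w\<bar> \<le> dist z w) \<and>
      (\<forall>n\<in>{n \<in> V. c n = i}. \<forall>z. \<phi> n z > 0 \<longrightarrow> G i z = \<phi> n z) \<and>
      (\<forall>z. (\<forall>n\<in>{n \<in> V. c n = i}. \<phi> n z \<le> 0) \<longrightarrow> G i z = 0)"
    by (elim exE)
  have G_lip: "\<bar>G i z - G i w\<bar> \<le> dist z w" for i z w
    using G by simp
  have G_bump: "G (c n) z = \<phi> n z" if "n \<in> V" "\<phi> n z > 0" for n z
    using spec[OF G, of "c n"] that by blast
  have G_zero: "G i z = 0" if "\<forall>n\<in>V. c n = i \<longrightarrow> \<phi> n z \<le> 0" for i z
    using spec[OF G, of i] that by blast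
  \<comment> \<open>Colours 0 to \<Delta> occupy the coordinates \<open>m\<close> to
    \<open>m + \<Delta>\<close>, hence the value of \<open>D\<close>. Later coordinates are 0, as
    membership in \<open>Euclidean_space D\<close> demands.\<close>
  define H where "H z j = (if j < m then h (f z) j else if j \<le> m + \<Delta> then G (j - m) z else 0)" for z j
  define D where "D = m + \<Delta> + 1"
  \<comment> \<open>One summand for each estimate: the upper bound, separation through
    \<open>f\<close>, and separation through a colour.\<close>
  define L' where "L' = real D * (L0 * \<Lambda> + 1) + 2 * L0 / \<epsilon> + 4 / \<eta>"
  have up: "L2_set (\<lambda>j. H x j - H y j) {..<D} \<le> L' * dist x y" for x y
  proof -
    have "\<bar>H x j - H y j\<bar> \<le> (L0 * \<Lambda> + 1) * dist x y" for j
    proof (cases "j < m")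
      case True
      then have "\<bar>h (f x) j - h (f y) j\<bar> \<le> L2_set (\<lambda>i. h (f x) i - h (f y) i) {..<m}"
        using member_le_L2_set[of "{..<m}" j "\<lambda>i. \<bar>h (f x) i - h (f y) i\<bar>"]
        by (simp add: L2_set_def)
      also have "\<dots> \<le> L0 * dist (f x) (f y)" by (rule h)
      also have "\<dots> \<le> L0 * (\<Lambda> * dist x y)"
        using L(1) h(1) by (intro mult_left_mono) auto
      also have "\<dots> \<le> (L0 * \<Lambda> + 1) * dist x y" by (simp add: algebra_simps)
      finally show ?thesis using True by (simp add: H_def)
    next
      case False
      have "\<bar>H x j - H y j\<bar> \<le> 1 * dist x y"
        using False G_lip[of "j - m" x y] by (simp add: H_def)
      also have "\<dots> \<le> (L0 * \<Lambda> + 1) * dist x y"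
        using h(1) L(2) by (intro mult_right_mono) auto
      finally show ?thesis .
    qed
    then have "(\<Sum>j<D. \<bar>H x j - H y j\<bar>) \<le> (\<Sum>j<D. (L0 * \<Lambda> + 1) * dist x y)"
      by (intro sum_mono)
    then have "L2_set (\<lambda>j. H x j - H y j) {..<D} \<le> real D * (L0 * \<Lambda> + 1) * dist x y"
      using L2_set_le_sum_abs[of "\<lambda>j. H x j - H y j" "{..<D}"] by simp
    also have "\<dots> \<le> L' * dist x y"
      using h(1) \<epsilon>0 \<eta>0 by (intro mult_right_mono) (auto simp: L'_def)
    finally show ?thesis .
  qed
  have lo: "inverse L' * dist x y \<le> L2_set (\<lambda>j. H x j - H y j) {..<D}" for x y
  proof (cases "x = y")
    case False
    then have "dist x y > 0" by simp
    then obtain k where k: "dyadic k \<le> dist x y" "dist x y < 2 * dyadic k"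
      by (rule exists_scale)
    have "L' \<ge> 2 * L0 / \<epsilon>" "L' \<ge> 4 / \<eta>" "2 * L0 / \<epsilon> > 0" "4 / \<eta> > 0"
      using h(1) L(2) \<epsilon>0 \<eta>0 by (auto simp: L'_def)
    then have L': "inverse L' \<le> inverse (2 * L0 / \<epsilon>)" "inverse L' \<le> inverse (4 / \<eta>)"
      by (auto intro!: le_imp_inverse_le simp del: inverse_divide)
    show ?thesis
    proof (cases "dist (f x) (f y) \<le> \<epsilon> * dyadic k")
      case True
      \<comment> \<open>The witness is \<open>y\<close> itself.\<close>
      then have "x \<in> ramified_at f \<epsilon> k"
        using k unfolding ramified_at_def by blast
      then obtain p where p: "p \<in> P k" "dist x p < \<eta> * dyadic k"
        using P(3) by blast
      define n where "n = (p, k)"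
      have n: "n \<in> V" using p by (simp add: V_def n_def)
      have \<phi>x: "\<phi> n x > \<eta> * dyadic k"
        using p by (simp add: \<phi>_def n_def)
      then have Gx: "G (c n) x = \<phi> n x"
        using n G_bump[of n x] \<eta>0 by (smt (verit) mult_pos_pos dyadic_pos)
      \<comment> \<open>At \<open>y\<close> the colour of \<open>n\<close> is silent or carries a
        bump of scale at most \<open>k - 2\<close>, since one of larger scale would conflict with
        \<open>n\<close>. Such a bump has height at most half of \<open>\<eta> * dyadic k\<close>,
        so it cannot match the value at \<open>x\<close>.\<close>
      have Gy: "G (c n) y \<le> \<eta> * dyadic k / 2"
      proof (cases "\<exists>n'\<in>V. c n' = c n \<and> \<phi> n' y > 0")
        case True
        then obtain n' where n': "n' \<in> V" "c n' = c n" "\<phi> n' y > 0" by blast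
        obtain p' k' where pk: "n' = (p', k')" by fastforce
        have y: "dist y p' < 2 * \<eta> * dyadic k'"
          using n'(3) by (auto simp: \<phi>_def pk max_def split: if_splits)
        have "k' \<le> k - 2"
        proof (rule ccontr)
          assume *: "\<not> k' \<le> k - 2"
          have "dist p p' \<le> dist x p + dist x y + dist y p'"
            using dist_triangle3[of p p' x] dist_triangle[of x p' y] by simp
          also have "\<dots> \<le> 4 * dyadic k + 2 * \<eta> * dyadic k'"
            using p y k \<eta>s[of k] dyadic_pos[of k] by linarith
          finally have d: "dist p p' \<le> 4 * dyadic k + 2 * \<eta> * dyadic k'" .
          \<comment> \<open>The bump of \<open>n\<close> does not reach \<open>y\<close>: it is
            centred near \<open>x\<close> and its radius is a small fraction of
            \<open>dyadic k\<close>, hence of \<open>dist x y\<close>.\<close>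
          have "n \<noteq> n'"
          proof
            assume "n = n'"
            then have "dist y p < 2 * \<eta> * dyadic k" using y by (simp add: n_def pk)
            then show False
              using dist_triangle[of x y p] p(2) k(1) \<eta>s[of k] dyadic_pos[of k]
              by (simp add: dist_commute)
          qed
          moreover have "dist p p' \<le> 8 * min (dyadic k) (dyadic k') + 2 * \<eta> * max (dyadic k) (dyadic k')"
          proof (cases "k \<le> k'")
            case True
            then have "min (dyadic k) (dyadic k') = dyadic k" "max (dyadic k) (dyadic k') = dyadic k'"
              by simp_all
            then show ?thesis
              using d dyadic_pos[of k] by linarith
          next
            case False
            with * have "k = k' + 1" by simp
            then have "min (dyadic k) (dyadic k') = dyadic k'" "max (dyadic k) (dyadic k') = 2 * dyadic k'"
              "dyadic k = 2 * dyadic k'"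
              by simp_all
            moreover have "\<eta> * dyadic k' > 0" using \<eta>0 by simp
            ultimately show ?thesis
              using d by simp
          qed
          ultimately have "close_nodes \<eta> n n'"
            by (simp add: close_nodes_def n_def pk)
          then show False using c(2) n n' by metis
        qed
        then have "dyadic (k' + 2) \<le> dyadic k" by simp
        then have "4 * dyadic k' \<le> dyadic k"
          using dyadic_nat[of 2] by (simp add: dyadic_add)
        then have "2 * \<eta> * dyadic k' \<le> \<eta> * dyadic k / 2"
          using mult_left_mono[of "4 * dyadic k'" "dyadic k" \<eta>] \<eta>0 by simp
        moreover have "\<phi> n' y \<le> 2 * \<eta> * dyadic k'"
          using \<eta>0 by (simp add: \<phi>_def pk)
        ultimately show ?thesis using G_bump[OF n'(1,3)] n'(2) by simp
      next
        case False
        then have "G (c n) y = 0" by (intro G_zero) (auto simp: not_less)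
        then show ?thesis using \<eta>0 by simp
      qed
      have "m + c n < D" using c(1)[OF n] by (simp add: D_def)
      have H_diff: "H x (m + c n) - H y (m + c n) = G (c n) x - G (c n) y"
        using c(1)[OF n] by (simp add: H_def)
      have "inverse L' * dist x y \<le> inverse (4 / \<eta>) * (2 * dyadic k)"
        using L'(2) k \<eta>0 by (intro mult_mono) auto
      also have "\<dots> = \<eta> * dyadic k / 2" by simp
      also have "\<dots> \<le> \<bar>H x (m + c n) - H y (m + c n)\<bar>"
        using Gx Gy \<phi>x H_diff by linarith
      also have "\<dots> \<le> L2_set (\<lambda>j. H x j - H y j) {..<D}"
        using member_le_L2_set[of "{..<D}" "m + c n" "\<lambda>j. \<bar>H x j - H y j\<bar>"] \<open>m + c n < D\<close>
        by (simp add: L2_set_def)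
      finally show ?thesis .
    next
      case False
      have "inverse L' * dist x y \<le> inverse (2 * L0 / \<epsilon>) * (2 * dyadic k)"
        using L'(1) k h(1) \<epsilon>0 by (intro mult_mono) auto
      also have "\<dots> = inverse L0 * (\<epsilon> * dyadic k)" by (simp add: field_simps)
      also have "\<dots> \<le> inverse L0 * dist (f x) (f y)"
        using False h(1) by (intro mult_left_mono) auto
      also have "\<dots> \<le> L2_set (\<lambda>i. h (f x) i - h (f y) i) {..<m}" by (rule h)
      also have "\<dots> = L2_set (\<lambda>j. H x j - H y j) {..<m}"
        by (rule L2_set_cong) (auto simp: H_def)
      also have "\<dots> \<le> L2_set (\<lambda>j. H x j - H y j) {..<D}"
        unfolding L2_set_def by (intro real_sqrt_le_mono sum_mono2) (auto simp: D_def)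
      finally show ?thesis .
    qed
  qed simp
  have "L0 * \<Lambda> \<ge> 0" "real D \<ge> 1" using h(1) L(2) by (auto simp: D_def)
  then have "real D * (L0 * \<Lambda> + 1) \<ge> 1"
    using mult_mono[of 1 "real D" 1 "L0 * \<Lambda> + 1"] by simp
  then have "L' \<ge> 1"
    using h(1) \<epsilon>0 \<eta>0 by (simp add: L'_def add_nonneg_nonneg add_increasing2)
  moreover have "H z \<in> topspace (Euclidean_space D)" for z
    by (auto simp: topspace_Euclidean_space H_def D_def)
  ultimately show ?thesis
    unfolding bilipschitz_embeds_Euclidean_def using lo up
    by (intro exI[of _ D] exI[of _ H] exI[of _ L']) auto
qed

section \<open>Path lifting\<close>

text \<open>The relation of lying in one quasi-component. Unlike components, quasi-components are
  tested on single clopen sets, which can be intersected finitely and pushed forward by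
  \<open>f\<close>. For \<open>x\<close> outside \<open>S\<close> the condition is vacuous, so
  membership is carried along separately.\<close>

definition clopen_linked :: "'a::topological_space set \<Rightarrow> 'a \<Rightarrow> 'a \<Rightarrow> bool" where
  "clopen_linked S x y \<longleftrightarrow>
    (\<forall>C. openin (top_of_set S) C \<longrightarrow> closedin (top_of_set S) C \<longrightarrow> x \<in> C \<longrightarrow> y \<in> C)"

lemma clopen_linked_refl: "clopen_linked S x x"
  by (simp add: clopen_linked_def)

lemma clopen_linked_trans:
  assumes "clopen_linked S x y" "clopen_linked T y z" "S \<subseteq> U" "T \<subseteq> U" "x \<in> S" "y \<in> T"
  shows "clopen_linked U x z"
  unfolding clopen_linked_def
proof (intro allI impI)
  fix C assume C: "openin (top_of_set U) C" "closedin (top_of_set U) C" "x \<in> C"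
  have "openin (top_of_set S) (S \<inter> C)" "closedin (top_of_set S) (S \<inter> C)"
    using C assms(3) unfolding openin_open closedin_closed by blast+
  then have "y \<in> C" using assms(1,5) C(3) unfolding clopen_linked_def by blast
  have "openin (top_of_set T) (T \<inter> C)" "closedin (top_of_set T) (T \<inter> C)"
    using C assms(4) unfolding openin_open closedin_closed by blast+
  then show "z \<in> C" using assms(2,6) \<open>y \<in> C\<close> unfolding clopen_linked_def by blast
qed

lemma clopen_linkedD_sym:
  assumes "clopen_linked S x y" "x \<in> S" "openin (top_of_set S) C" "closedin (top_of_set S) C" "y \<in> C"
  shows "x \<in> C"
proof (rule ccontr)
  assume "x \<notin> C"
  moreover have "openin (top_of_set S) (S - C)" "closedin (top_of_set S) (S - C)"
    using assms(3,4) by (auto intro: openin_diff closedin_diff)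
  ultimately show False
    using assms(1,2,5) unfolding clopen_linked_def by blast
qed

lemma locally_compact_UNIV_cball:
  assumes "locally compact (UNIV :: 'a::metric_space set)"
  obtains e where "e > 0" "compact (cball (x :: 'a) e)"
proof -
  obtain U V where UV: "open U" "compact V" "x \<in> U" "U \<subseteq> V"
    using locallyE[OF assms, of UNIV x] by (auto simp: openin_open)
  then obtain e where e: "e > 0" "cball x e \<subseteq> U"
    by (metis open_contains_cball)
  have "cball x e = V \<inter> cball x e" using e UV by blast
  then have "compact (cball x e)" using UV(2) by (metis closed_cball compact_Int_closed)
  with e show thesis using that by blast
qed

text \<open>The gap \<sigma> keeps points whose images are within \<sigma> of \<open>f x\<close> off
  the sphere of radius \<rho>, so among such points the open and the closed ball agree. The clopen
  and compact sets used for lifting arise in this way.\<close>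

lemma isolating_ball:
  fixes f :: "'a::metric_space \<Rightarrow> 'b::metric_space"
  assumes cont: "continuous_on UNIV f" and fin: "finite (f -` {f x})"
    and lc: "locally compact (UNIV :: 'a set)" and \<rho>0: "\<rho>0 > 0"
  obtains \<rho> \<sigma> where "0 < \<rho>" "\<rho> < \<rho>0" "0 < \<sigma>" "compact (cball x \<rho>)"
    "\<And>z. z \<in> cball x \<rho> \<Longrightarrow> f z = f x \<Longrightarrow> z = x"
    "\<And>z. dist x z = \<rho> \<Longrightarrow> \<sigma> \<le> dist (f x) (f z)"
proof -
  obtain e where e: "e > 0" "compact (cball x e)"
    using locally_compact_UNIV_cball[OF lc] .
  obtain d where d: "d > 0" "\<And>z. z \<in> f -` {f x} \<Longrightarrow> z \<noteq> x \<Longrightarrow> d \<le> dist x z"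
    using finite_set_avoid[OF fin] by blast
  define \<rho> where "\<rho> = min \<rho>0 (min e d) / 2"
  have \<rho>: "0 < \<rho>" "\<rho> < \<rho>0" "\<rho> < e" "\<rho> < d"
    using \<rho>0 e d by (auto simp: \<rho>_def)
  have "cball x \<rho> = cball x e \<inter> cball x \<rho>" using \<rho> by auto
  then have comp: "compact (cball x \<rho>)" using e(2) by (metis closed_cball compact_Int_closed)
  have iso: "z = x" if "z \<in> cball x \<rho>" "f z = f x" for z
    using d(2)[of z] that \<rho> by fastforce
  have "compact (cball x \<rho> - ball x \<rho>)"
    using comp open_ball by (rule compact_diff)
  then have "compact (f ` (cball x \<rho> - ball x \<rho>))"
    using cont by (meson compact_continuous_image continuous_on_subset subset_UNIV)
  then have "open (- f ` (cball x \<rho> - ball x \<rho>))"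
    by (simp add: compact_imp_closed open_Compl)
  moreover have "f x \<in> - f ` (cball x \<rho> - ball x \<rho>)"
    using iso \<rho>(1) by fastforce
  ultimately obtain \<sigma> where \<sigma>: "\<sigma> > 0" "ball (f x) \<sigma> \<subseteq> - f ` (cball x \<rho> - ball x \<rho>)"
    by (metis open_contains_ball)
  have "\<sigma> \<le> dist (f x) (f z)" if "dist x z = \<rho>" for z
  proof (rule ccontr)
    assume "\<not> ?thesis"
    then have "f z \<in> ball (f x) \<sigma>" by simp
    then show False using \<sigma>(2) that by auto
  qed
  with \<rho> \<sigma>(1) comp iso show thesis using that by blast
qed

text \<open>Every clopen piece of \<open>S\<close> containing \<open>x\<close> maps onto
  \<open>A\<close>: its image is open in \<open>A\<close> because \<open>f\<close> is open, closed
  because the piece is compact, and \<open>A\<close> is connected. If no point of the finite fibre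
  over \<open>y\<close> were linked to \<open>x\<close>, intersecting finitely many separating
  pieces would give one that misses the fibre.\<close>

lemma clopen_linked_lift:
  fixes f :: "'a::metric_space \<Rightarrow> 'b::metric_space"
  assumes cont: "continuous_on UNIV f" and opn: "open_map euclidean euclidean f"
    and fin: "finite (f -` {y})"
    and A: "connected A" "y \<in> A"
    and S: "S = W \<inter> f -` A" "open W" "compact S" and x: "x \<in> S"
  shows "\<exists>x'\<in>S. f x' = y \<and> clopen_linked S x x'"
proof -
  have onto: "f ` C = A" if C: "openin (top_of_set S) C" "closedin (top_of_set S) C" "x \<in> C" for C
  proof -
    obtain T where T: "open T" "C = S \<inter> T"
      using C(1) by (auto simp: openin_open)
    have "f ` C = A \<inter> f ` (W \<inter> T)"
      using S(1) T(2) by auto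
    moreover have "open (f ` (W \<inter> T))"
      using opn S(2) T(1) by (auto simp: open_map_def)
    ultimately have "openin (top_of_set A) (f ` C)"
      by (auto simp: openin_open)
    moreover have "compact C"
      using C(2) S(3) closedin_compact by blast
    then have "compact (f ` C)"
      using cont by (meson compact_continuous_image continuous_on_subset subset_UNIV)
    then have "closedin (top_of_set A) (f ` C)"
      using \<open>f ` C = _\<close> by (auto intro: closed_subset compact_imp_closed)
    ultimately have "f ` C = {} \<or> f ` C = A"
      using A(1) connected_clopen by blast
    then show ?thesis using C(3) by auto
  qed
  show ?thesis
  proof (rule ccontr)
    assume no: "\<not> ?thesis"
    define F where "F = S \<inter> f -` {y}"
    have "\<exists>C. openin (top_of_set S) C \<and> closedin (top_of_set S) C \<and> x \<in> C \<and> x' \<notin> C" if "x' \<in> F" for x'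
      using no that unfolding F_def clopen_linked_def by blast
    then obtain c where c: "\<And>x'. x' \<in> F \<Longrightarrow> openin (top_of_set S) (c x')"
      "\<And>x'. x' \<in> F \<Longrightarrow> closedin (top_of_set S) (c x')"
      "\<And>x'. x' \<in> F \<Longrightarrow> x \<in> c x' \<and> x' \<notin> c x'"
      by metis
    \<comment> \<open>Inserting \<open>S\<close> keeps \<open>C\<close> inside \<open>S\<close> even
      when \<open>F\<close> is empty.\<close>
    define C where "C = \<Inter>(insert S (c ` F))"
    have "finite F" using fin by (simp add: F_def)
    then have "openin (top_of_set S) C"
      unfolding C_def using c(1) by (intro openin_Inter) auto
    moreover have "closedin (top_of_set S) C"
      unfolding C_def using c(2) by (intro closedin_Inter) auto
    moreover have "x \<in> C" using c(3) x by (auto simp: C_def)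
    ultimately have "y \<in> f ` C" using onto A(2) by blast
    then obtain x' where "x' \<in> C" "f x' = y" by blast
    then have "x' \<in> F" by (auto simp: F_def C_def)
    then show False using c(3)[of x'] \<open>x' \<in> C\<close> by (auto simp: C_def)
  qed
qed

text \<open>A lift is a choice of one fibre point per time such that the points at times
  \<open>s \<le> u\<close> are linked in the preimage of the subpath over \<open>{s..u}\<close>.
  Finitely many times are handled by induction, all times by \<open>finite_selection\<close>.
  Linking forces continuity, because small balls around a chosen point are clopen in the preimages
  of short subpaths.\<close>

lemma local_path_lift:
  fixes f :: "'a::metric_space \<Rightarrow> 'b::metric_space" and \<gamma> :: "real \<Rightarrow> 'b"
  assumes cont: "continuous_on UNIV f" and opn: "open_map euclidean euclidean f"
    and fin: "\<And>y. finite (f -` {y})" and lc: "locally compact (UNIV :: 'a set)"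
    and \<gamma>: "continuous_on {a..b} \<gamma>" and ab: "a < b" and x0: "f x0 = \<gamma> a"
  obtains t \<alpha> where "a < t" "t \<le> b" "continuous_on {a..t} \<alpha>" "\<alpha> a = x0"
    "\<And>u. u \<in> {a..t} \<Longrightarrow> f (\<alpha> u) = \<gamma> u"
proof -
  obtain \<rho> \<sigma> where \<rho>: "0 < \<rho>" "0 < \<sigma>" "compact (cball x0 \<rho>)"
    and \<sigma>: "\<And>z. dist x0 z = \<rho> \<Longrightarrow> \<sigma> \<le> dist (f x0) (f z)"
    using isolating_ball[OF cont fin lc, of 1 x0] by (metis zero_less_one)
  obtain d where d: "d > 0" "\<And>u. u \<in> {a..b} \<Longrightarrow> dist u a < d \<Longrightarrow> dist (\<gamma> u) (\<gamma> a) < \<sigma>"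
    using \<gamma> ab \<rho>(2) unfolding continuous_on_iff by (metis atLeastAtMost_iff less_imp_le order_refl)
  define t where "t = min b (a + d / 2)"
  have t: "a < t" "t \<le> b" using ab d by (auto simp: t_def)
  have near: "dist (\<gamma> u) (f x0) < \<sigma>" if "u \<in> {a..t}" for u
    using d that x0 by (auto simp: t_def dist_real_def)
  define S where "S s u = ball x0 \<rho> \<inter> f -` \<gamma> ` {s..u}" for s u
  have sub: "{s..u} \<subseteq> {a..b}" if "a \<le> s" "u \<le> t" for s u
    using that t by auto
  have S_comp: "compact (S s u)" if "a \<le> s" "u \<le> t" for s u
  proof -
    \<comment> \<open>Over \<open>{a..t}\<close> the path stays within \<sigma> of
      \<open>f x0\<close>, so no point of the preimage lies on the sphere.\<close>
    have "S s u = cball x0 \<rho> \<inter> f -` \<gamma> ` {s..u}"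
    proof -
      have "z \<in> ball x0 \<rho>" if "z \<in> cball x0 \<rho>" "f z = \<gamma> v" "v \<in> {s..u}" for z v
        using \<sigma>[of z] near[of v] that \<open>a \<le> s\<close> \<open>u \<le> t\<close> by (force simp: dist_commute)
      then show ?thesis by (auto simp: S_def)
    qed
    moreover have "compact (\<gamma> ` {s..u})"
      using \<gamma> sub[OF that] by (meson compact_Icc compact_continuous_image continuous_on_subset)
    then have "closed (f -` \<gamma> ` {s..u})"
      using cont by (simp add: closed_vimage compact_imp_closed continuous_on_eq_continuous_at)
    ultimately show ?thesis using \<rho>(3) by (simp add: compact_Int_closed)
  qed
  have S_conn: "connected (\<gamma> ` {s..u})" if "a \<le> s" "u \<le> t" for s u
    using \<gamma> sub[OF that] by (meson connected_Icc connected_continuous_image continuous_on_subset)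
  define R where "R s u x x' \<longleftrightarrow> (s \<le> u \<longrightarrow> clopen_linked (S s u) x x')" for s u x x'
  \<comment> \<open>The start is pinned to \<open>x0\<close>; at later times every fibre point in
    the ball is a candidate.\<close>
  define A where "A u = (if u = a then {x0} else ball x0 \<rho> \<inter> f -` {\<gamma> u})" for u
  have A_sub: "x \<in> ball x0 \<rho> \<and> f x = \<gamma> u" if "x \<in> A u" for x u
    using that x0 \<rho>(1) by (auto simp: A_def split: if_splits)
  have fincons: "\<exists>c. (\<forall>i\<in>insert a J. c i \<in> A i) \<and> (\<forall>i\<in>insert a J. \<forall>j\<in>insert a J. R i j (c i) (c j))"
    if "finite J" "J \<subseteq> {a<..t}" for J
    using that
  proof (induction J rule: finite_linorder_max_induct)
    case empty
    show ?case
      by (intro exI[of _ "\<lambda>_. x0"]) (simp add: A_def R_def clopen_linked_refl)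
  next
    case (insert v J)
    then obtain c where c: "\<And>i. i \<in> insert a J \<Longrightarrow> c i \<in> A i"
      "\<And>i j. i \<in> insert a J \<Longrightarrow> j \<in> insert a J \<Longrightarrow> R i j (c i) (c j)"
      by (meson insert_subset)
    \<comment> \<open>The new point is linked only to the one at the latest earlier time;
      transitivity yields the links to all others.\<close>
    define w where "w = Max (insert a J)"
    have w: "w \<in> insert a J" "\<And>i. i \<in> insert a J \<Longrightarrow> i \<le> w"
      using insert.hyps(1) Max_in[of "insert a J"] Max_ge[of "insert a J"] unfolding w_def by blast+
    have v: "a < v" "v \<le> t" "v \<notin> insert a J" using insert by auto
    have wv: "a \<le> w" "w < v" using w insert v(1) by auto
    have "c w \<in> S w v"
      using A_sub[OF c(1)[OF w(1)]] wv by (auto simp: S_def)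
    then have "\<exists>x'\<in>S w v. f x' = \<gamma> v \<and> clopen_linked (S w v) (c w) x'"
      using clopen_linked_lift[OF cont opn fin S_conn[OF wv(1) v(2)] _ S_def open_ball
          S_comp[OF wv(1) v(2)], of "\<gamma> v" "c w"] wv(2) by auto
    then obtain x' where x': "x' \<in> S w v" "f x' = \<gamma> v" "clopen_linked (S w v) (c w) x'"
      by blast
    show ?case
    proof (intro exI[of _ "c(v := x')"] conjI ballI)
      fix i assume "i \<in> insert a (insert v J)"
      moreover have "x' \<in> A v"
        using x'(1,2) v(1) by (simp add: A_def S_def)
      ultimately show "(c(v := x')) i \<in> A i"
        using c(1)[of i] by auto
    next
      fix i j assume ij: "i \<in> insert a (insert v J)" "j \<in> insert a (insert v J)"
      consider "i = v" "j = v" | "i = v" "j \<in> insert a J" "j \<noteq> v" | "i \<in> insert a J" "i \<noteq> v" "j = v"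
        | "i \<in> insert a J" "j \<in> insert a J" "i \<noteq> v" "j \<noteq> v"
        using ij v(3) by auto
      then show "R i j ((c(v := x')) i) ((c(v := x')) j)"
      proof cases
        case 1
        then show ?thesis by (simp add: R_def clopen_linked_refl)
      next
        case 2
        then show ?thesis using w(2)[of j] wv by (auto simp: R_def)
      next
        case 3
        have iw: "i \<le> w" using w(2) 3 by blast
        have "clopen_linked (S i w) (c i) (c w)"
          using c(2)[OF 3(1) w(1)] iw by (simp add: R_def)
        then have "clopen_linked (S i v) (c i) x'"
        proof (rule clopen_linked_trans)
          show "clopen_linked (S w v) (c w) x'" by fact
          show "c i \<in> S i w" using A_sub[OF c(1)[OF 3(1)]] iw by (auto simp: S_def)
          show "c w \<in> S w v" by fact
        qed (use wv iw in \<open>auto simp: S_def\<close>)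
        then show ?thesis using 3 by (simp add: R_def)
      next
        case 4
        then show ?thesis using c(2) by simp
      qed
    qed
  qed
  have "\<exists>c. (\<forall>i\<in>{a..t}. c i \<in> A i) \<and> (\<forall>i\<in>{a..t}. \<forall>j\<in>{a..t}. R i j (c i) (c j))"
  proof (rule finite_selection)
    show "finite (A i)" for i using fin by (simp add: A_def)
    show "\<exists>c. (\<forall>i\<in>J. c i \<in> A i) \<and> (\<forall>i\<in>J. \<forall>j\<in>J. R i j (c i) (c j))"
      if "finite J" "J \<subseteq> {a..t}" for J
    proof -
      have "finite (J - {a})" "J - {a} \<subseteq> {a<..t}" using that by auto
      from fincons[OF this] show ?thesis by (metis insertCI insert_Diff_single)
    qed
  qed
  then obtain \<alpha> where \<alpha>: "\<And>i. i \<in> {a..t} \<Longrightarrow> \<alpha> i \<in> A i"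
    "\<And>i j. i \<in> {a..t} \<Longrightarrow> j \<in> {a..t} \<Longrightarrow> R i j (\<alpha> i) (\<alpha> j)"
    by blast
  have lift: "f (\<alpha> u) = \<gamma> u" "\<alpha> u \<in> ball x0 \<rho>" if "u \<in> {a..t}" for u
    using A_sub[OF \<alpha>(1)[OF that]] by auto
  have "continuous_on {a..t} \<alpha>"
    unfolding continuous_on_iff
  proof (intro ballI allI impI)
    fix u and e :: real assume u: "u \<in> {a..t}" and "e > 0"
    obtain \<rho>' \<sigma>' where \<rho>': "0 < \<rho>'" "\<rho>' < e" "0 < \<sigma>'"
      and \<sigma>': "\<And>z. dist (\<alpha> u) z = \<rho>' \<Longrightarrow> \<sigma>' \<le> dist (f (\<alpha> u)) (f z)"
      using isolating_ball[OF cont fin lc \<open>e > 0\<close>, of "\<alpha> u"] by metis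
    obtain d' where d': "d' > 0" "\<And>v. v \<in> {a..b} \<Longrightarrow> dist v u < d' \<Longrightarrow> dist (\<gamma> v) (\<gamma> u) < \<sigma>'"
      using \<gamma> u t(2) \<rho>'(3) unfolding continuous_on_iff by (metis atLeastAtMost_iff order_trans)
    show "\<exists>d>0. \<forall>v\<in>{a..t}. dist v u < d \<longrightarrow> dist (\<alpha> v) (\<alpha> u) < e"
    proof (intro exI[of _ d'] conjI ballI impI)
      fix v assume v: "v \<in> {a..t}" "dist v u < d'"
      define s w where "s = min u v" and "w = max u v"
      have sw: "a \<le> s" "w \<le> t" "s \<le> w" "u \<in> {s..w}" "v \<in> {s..w}"
        using u v by (auto simp: s_def w_def)
      \<comment> \<open>Between \<open>u\<close> and \<open>v\<close> the path stays within
        \<open>\<sigma>'\<close> of \<open>\<gamma> u\<close>, so the small ball is clopen in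
        \<open>S s w\<close>. It contains \<open>\<alpha> u\<close>, hence also the linked point
        \<open>\<alpha> v\<close>.\<close>
      define B where "B = S s w \<inter> ball (\<alpha> u) \<rho>'"
      have "B = S s w \<inter> cball (\<alpha> u) \<rho>'"
      proof -
        have "z \<in> ball (\<alpha> u) \<rho>'" if "z \<in> cball (\<alpha> u) \<rho>'" "f z = \<gamma> v'" "v' \<in> {s..w}" for z v'
        proof -
          have "dist v' u \<le> dist v u" "v' \<in> {a..b}"
            using that(3) u v t by (auto simp: s_def w_def dist_real_def)
          then have "dist (\<gamma> v') (\<gamma> u) < \<sigma>'"
            using d'(2) v(2) by fastforce
          then show ?thesis
            using \<sigma>'[of z] that(1,2) lift(1)[OF u] by (force simp: dist_commute)
        qed
        then show ?thesis by (auto simp: B_def S_def)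
      qed
      then have B: "openin (top_of_set (S s w)) B" "closedin (top_of_set (S s w)) B"
        using B_def by (auto simp: openin_open closedin_closed)
      have mem: "\<alpha> u \<in> S s w" "\<alpha> v \<in> S s w"
        using lift[OF u] lift[OF v(1)] sw by (auto simp: S_def)
      then have uB: "\<alpha> u \<in> B" using \<rho>'(1) by (simp add: B_def)
      have "\<alpha> v \<in> B"
      proof (cases "u \<le> v")
        case True
        then have "clopen_linked (S s w) (\<alpha> u) (\<alpha> v)"
          using \<alpha>(2)[OF u v(1)] by (simp add: R_def s_def w_def)
        then show ?thesis using B uB unfolding clopen_linked_def by blast
      next
        case False
        then have "clopen_linked (S s w) (\<alpha> v) (\<alpha> u)"
          using \<alpha>(2)[OF v(1) u] by (simp add: R_def s_def w_def)
        then show ?thesis using clopen_linkedD_sym[OF _ mem(2) B uB] by blast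
      qed
      then show "dist (\<alpha> v) (\<alpha> u) < e"
        using \<rho>'(2) by (simp add: B_def dist_commute)
    qed (rule d'(1))
  qed
  moreover have "\<alpha> a = x0" using \<alpha>(1)[of a] t(1) by (simp add: A_def)
  ultimately show thesis using that[OF t] lift(1) by blast
qed

text \<open>The modulus \<open>\<omega>\<close> keeps the lift from escaping in finite time; it is the only place where the
  distortion bounds on \<open>f\<close> enter the construction of lifts.\<close>

lemma path_lift:
  fixes f :: "'a::metric_space \<Rightarrow> 'b::metric_space" and \<gamma> :: "real \<Rightarrow> 'b"
    and \<omega> :: "real \<Rightarrow> real \<Rightarrow> real"
  assumes cont: "continuous_on UNIV f" and opn: "open_map euclidean euclidean f"
    and fin: "\<And>y. finite (f -` {y})" and lc: "locally compact (UNIV :: 'a set)"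
    and compl: "complete (UNIV :: 'a set)"
    and \<gamma>: "continuous_on {0..1} \<gamma>" and x0: "f x0 = \<gamma> 0"
    and mod: "\<And>s t \<alpha>. 0 \<le> s \<Longrightarrow> s \<le> t \<Longrightarrow> t \<le> 1 \<Longrightarrow> continuous_on {s..t} \<alpha> \<Longrightarrow>
      (\<And>u. u \<in> {s..t} \<Longrightarrow> f (\<alpha> u) = \<gamma> u) \<Longrightarrow> dist (\<alpha> s) (\<alpha> t) \<le> \<omega> s t"
    and \<omega>: "\<And>e. e > 0 \<Longrightarrow> \<exists>d>0. \<forall>s t. 0 \<le> s \<longrightarrow> s \<le> t \<longrightarrow> t \<le> 1 \<longrightarrow> t - s < d \<longrightarrow> \<omega> s t < e"
  shows "\<exists>\<alpha>. continuous_on {0..1} \<alpha> \<and> \<alpha> 0 = x0 \<and> (\<forall>u\<in>{0..1}. f (\<alpha> u) = \<gamma> u)"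
proof -
  define lifts where "lifts T \<alpha> \<longleftrightarrow> continuous_on {0..T} \<alpha> \<and> \<alpha> 0 = x0 \<and> (\<forall>u\<in>{0..T}. f (\<alpha> u) = \<gamma> u)"
    for T and \<alpha> :: "real \<Rightarrow> 'a"
  define I where "I = {T \<in> {0..1}. \<exists>\<alpha>. lifts T \<alpha>}"
  define T where "T = Sup I"
  have I0: "0 \<in> I"
    using x0 by (auto simp: I_def lifts_def intro!: exI[of _ "\<lambda>_. x0"])
  have bdd: "bdd_above I" by (rule bdd_aboveI[of _ 1]) (simp add: I_def)
  have T_up: "t \<le> T" if "t \<in> I" for t
    using that bdd unfolding T_def by (rule cSup_upper)
  have T0: "T \<ge> 0" using T_up[OF I0] .
  have T1: "T \<le> 1"
    unfolding T_def
  proof (rule cSup_least)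
    show "I \<noteq> {}" using I0 by blast
  qed (simp add: I_def)
  have below: "\<exists>\<alpha>. lifts t \<alpha>" if "t < T" for t
  proof -
    have "\<exists>t'\<in>I. t < t'"
      using that bdd I0 less_cSup_iff[of I t] unfolding T_def by blast
    then obtain t' where "t' \<in> I" "t < t'" by blast
    then obtain \<alpha> where "lifts t' \<alpha>" by (auto simp: I_def)
    then have "lifts t \<alpha>"
      using \<open>t < t'\<close> unfolding lifts_def
      by (auto intro: continuous_on_subset[of "{0..t'}"])
    then show ?thesis by blast
  qed
  have "\<exists>\<beta>. lifts T \<beta>"
  proof (cases "T = 0")
    case True
    then show ?thesis using I0 by (simp add: I_def)
  next
    case False
    then have Tpos: "T > 0" using T0 by simp
    \<comment> \<open>Lifts over \<open>{0..t}\<close> for different \<open>t < T\<close> need not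
      extend one another, so a coherent one on \<open>{0..<T}\<close> is selected by compactness.
      Continuity is not a condition on pairs of times, but the modulus is, and it yields uniform
      continuity, hence a limit at \<open>T\<close>.\<close>
    define A where "A u = (if u = 0 then {x0} else f -` {\<gamma> u})" for u
    define R where "R s u x x' \<longleftrightarrow> (s \<le> u \<longrightarrow> dist x x' \<le> \<omega> s u)" for s u and x x' :: 'a
    have "\<exists>c. (\<forall>i\<in>{0..<T}. c i \<in> A i) \<and> (\<forall>i\<in>{0..<T}. \<forall>j\<in>{0..<T}. R i j (c i) (c j))"
    proof (rule finite_selection)
      show "finite (A i)" for i using fin by (simp add: A_def)
      show "\<exists>c. (\<forall>i\<in>J. c i \<in> A i) \<and> (\<forall>i\<in>J. \<forall>j\<in>J. R i j (c i) (c j))"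
        if J: "finite J" "J \<subseteq> {0..<T}" for J
      proof -
        define t where "t = Max (insert 0 J)"
        have "t \<in> insert 0 J" unfolding t_def using J(1) by (intro Max_in) auto
        then have t: "t < T" using J(2) Tpos by auto
        have le: "i \<le> t" if "i \<in> J" for i
          using J(1) that by (simp add: t_def)
        obtain \<alpha> where \<alpha>: "lifts t \<alpha>" using below[OF t] by blast
        have "\<alpha> i \<in> A i" if "i \<in> J" for i
          using \<alpha> le[OF that] J(2) that by (auto simp: A_def lifts_def)
        moreover have "R i j (\<alpha> i) (\<alpha> j)" if ij: "i \<in> J" "j \<in> J" for i j
          unfolding R_def
        proof
          assume "i \<le> j"
          show "dist (\<alpha> i) (\<alpha> j) \<le> \<omega> i j"
          proof (rule mod)
            show "0 \<le> i" "i \<le> j" "j \<le> 1"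
              using ij J(2) T1 \<open>i \<le> j\<close> by auto
            have "{i..j} \<subseteq> {0..t}"
              using le[OF ij(2)] ij J(2) by auto
            then show "continuous_on {i..j} \<alpha>"
              using \<alpha> unfolding lifts_def by (meson continuous_on_subset)
            show "f (\<alpha> u) = \<gamma> u" if "u \<in> {i..j}" for u
              using \<alpha> le[OF ij(2)] ij J(2) that unfolding lifts_def by auto
          qed
        qed
        ultimately show ?thesis by blast
      qed
    qed
    then obtain \<alpha> where \<alpha>: "\<forall>i\<in>{0..<T}. \<alpha> i \<in> A i"
      "\<forall>i\<in>{0..<T}. \<forall>j\<in>{0..<T}. R i j (\<alpha> i) (\<alpha> j)"
      by blast
    have lift: "f (\<alpha> u) = \<gamma> u" if "u \<in> {0..<T}" for u
      using bspec[OF \<alpha>(1) that] x0 by (auto simp: A_def split: if_splits)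
    have \<alpha>0: "\<alpha> 0 = x0" using bspec[OF \<alpha>(1), of 0] Tpos by (simp add: A_def)
    have unif: "\<exists>d>0. \<forall>s\<in>{0..<T}. \<forall>u\<in>{0..<T}. \<bar>s - u\<bar> < d \<longrightarrow> dist (\<alpha> s) (\<alpha> u) < e" if "e > 0" for e
    proof -
      obtain d where d: "d > 0" "\<forall>s t. 0 \<le> s \<longrightarrow> s \<le> t \<longrightarrow> t \<le> 1 \<longrightarrow> t - s < d \<longrightarrow> \<omega> s t < e"
        using \<omega>[OF \<open>e > 0\<close>] by blast
      have le: "dist (\<alpha> s) (\<alpha> u) < e" if "s \<in> {0..<T}" "u \<in> {0..<T}" "s \<le> u" "u - s < d" for s u
      proof -
        have "dist (\<alpha> s) (\<alpha> u) \<le> \<omega> s u"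
          using bspec[OF bspec[OF \<alpha>(2) that(1)] that(2)] that(3) by (simp add: R_def)
        also have "\<dots> < e" using d(2) that T1 by auto
        finally show ?thesis .
      qed
      have "dist (\<alpha> s) (\<alpha> u) < e" if "s \<in> {0..<T}" "u \<in> {0..<T}" "\<bar>s - u\<bar> < d" for s u
        using le[OF that(1,2)] le[OF that(2,1)] that(3) by (cases "s \<le> u") (auto simp: dist_commute)
      with d(1) show ?thesis by blast
    qed
    define \<tau> where "\<tau> n = T - T / (real n + 1)" for n
    have \<tau>: "\<tau> n \<in> {0..<T}" for n
      using Tpos by (auto simp: \<tau>_def divide_le_eq)
    have \<tau>_lim: "\<tau> \<longlonglongrightarrow> T"
    proof -
      have "(\<lambda>n. T - T * inverse (real (Suc n))) \<longlonglongrightarrow> T - T * 0"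
        by (intro tendsto_intros LIMSEQ_inverse_real_of_nat)
      moreover have "\<tau> = (\<lambda>n. T - T * inverse (real (Suc n)))"
        by (rule ext) (simp add: \<tau>_def divide_inverse add.commute)
      ultimately show ?thesis by simp
    qed
    have "Cauchy (\<lambda>n. \<alpha> (\<tau> n))"
    proof (rule metric_CauchyI)
      fix e :: real assume "e > 0"
      then obtain d where d: "d > 0"
        "\<forall>s\<in>{0..<T}. \<forall>u\<in>{0..<T}. \<bar>s - u\<bar> < d \<longrightarrow> dist (\<alpha> s) (\<alpha> u) < e"
        using unif by blast
      have "Cauchy \<tau>" using \<tau>_lim by (rule LIMSEQ_imp_Cauchy)
      then obtain M where "\<forall>m\<ge>M. \<forall>n\<ge>M. dist (\<tau> m) (\<tau> n) < d"
        using d(1) unfolding Cauchy_def by blast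
      then have "\<forall>m\<ge>M. \<forall>n\<ge>M. dist (\<alpha> (\<tau> m)) (\<alpha> (\<tau> n)) < e"
        using d(2) \<tau> by (simp add: dist_real_def)
      then show "\<exists>M. \<forall>m\<ge>M. \<forall>n\<ge>M. dist (\<alpha> (\<tau> m)) (\<alpha> (\<tau> n)) < e" by blast
    qed
    then obtain l where l: "(\<lambda>n. \<alpha> (\<tau> n)) \<longlonglongrightarrow> l"
      using compl unfolding complete_def by auto
    define \<beta> where "\<beta> = \<alpha>(T := l)"
    have to_l: "\<exists>d>0. \<forall>s\<in>{0..<T}. T - s < d \<longrightarrow> dist (\<alpha> s) l < e" if "e > 0" for e
    proof -
      obtain d where d: "d > 0"
        "\<forall>s\<in>{0..<T}. \<forall>u\<in>{0..<T}. \<bar>s - u\<bar> < d \<longrightarrow> dist (\<alpha> s) (\<alpha> u) < e / 2"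
        using unif[of "e / 2"] \<open>e > 0\<close> by auto
      have "dist (\<alpha> s) l < e" if s: "s \<in> {0..<T}" "T - s < d" for s
      proof -
        have "\<forall>\<^sub>F n in sequentially. s < \<tau> n"
          using \<tau>_lim s(1) by (intro order_tendstoD(1)[OF \<tau>_lim]) auto
        then have "\<forall>\<^sub>F n in sequentially. dist (\<alpha> s) (\<alpha> (\<tau> n)) \<le> e / 2"
        proof eventually_elim
          case (elim n)
          have "\<bar>s - \<tau> n\<bar> < d" using elim \<tau>[of n] s by auto
          then show ?case using d(2) s(1) \<tau>[of n] by (meson less_imp_le)
        qed
        moreover have "(\<lambda>n. dist (\<alpha> s) (\<alpha> (\<tau> n))) \<longlonglongrightarrow> dist (\<alpha> s) l"
          by (intro tendsto_intros l)
        ultimately have "dist (\<alpha> s) l \<le> e / 2"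
          by (intro tendsto_upperbound[OF _ _ sequentially_bot])
        then show ?thesis using \<open>e > 0\<close> by simp
      qed
      with d(1) show ?thesis by blast
    qed
    have "continuous_on {0..T} \<beta>"
      unfolding continuous_on_iff
    proof (intro ballI allI impI)
      fix u e :: real assume u: "u \<in> {0..T}" and e: "e > 0"
      obtain d1 where d1: "d1 > 0" "\<forall>s\<in>{0..<T}. T - s < d1 \<longrightarrow> dist (\<alpha> s) l < e"
        using to_l[OF e] by blast
      obtain d2 where d2: "d2 > 0"
        "\<forall>s\<in>{0..<T}. \<forall>u\<in>{0..<T}. \<bar>s - u\<bar> < d2 \<longrightarrow> dist (\<alpha> s) (\<alpha> u) < e"
        using unif[OF e] by blast
      show "\<exists>d>0. \<forall>v\<in>{0..T}. dist v u < d \<longrightarrow> dist (\<beta> v) (\<beta> u) < e"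
      proof (cases "u = T")
        case True
        show ?thesis
          by (rule exI[of _ d1]) (use d1 e True in \<open>auto simp: \<beta>_def dist_real_def\<close>)
      next
        case False
        show ?thesis
          by (rule exI[of _ "min d2 (T - u)"])
             (use d2 False u in \<open>auto simp: \<beta>_def dist_real_def\<close>)
      qed
    qed
    moreover have "f l = \<gamma> T"
    proof (rule LIMSEQ_unique)
      show "(\<lambda>n. f (\<alpha> (\<tau> n))) \<longlonglongrightarrow> f l"
        using cont l by (auto simp: continuous_on_eq_continuous_at isCont_def intro: isCont_tendsto_compose)
      have "(\<lambda>n. \<gamma> (\<tau> n)) \<longlonglongrightarrow> \<gamma> T"
      proof (rule continuous_on_tendsto_compose[OF \<gamma> \<tau>_lim])
        have "\<tau> n \<in> {0..1}" for n using \<tau>[of n] T1 by auto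
        then show "\<forall>\<^sub>F n in sequentially. \<tau> n \<in> {0..1}" by simp
      qed (use T0 T1 in simp)
      then show "(\<lambda>n. f (\<alpha> (\<tau> n))) \<longlonglongrightarrow> \<gamma> T"
        using lift \<tau> by simp
    qed
    ultimately have "lifts T \<beta>"
      using lift \<alpha>0 Tpos by (auto simp: lifts_def \<beta>_def)
    then show ?thesis by blast
  qed
  then obtain \<beta> where \<beta>: "continuous_on {0..T} \<beta>" "\<beta> 0 = x0" "\<And>u. u \<in> {0..T} \<Longrightarrow> f (\<beta> u) = \<gamma> u"
    unfolding lifts_def by blast
  have "T = 1"
  proof (rule ccontr)
    assume "T \<noteq> 1"
    then have "T < 1" using T1 by simp
    have "continuous_on {T..1} \<gamma>"
      using \<gamma> T0 by (auto intro: continuous_on_subset)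
    then obtain t \<alpha>' where t: "T < t" "t \<le> 1" "continuous_on {T..t} \<alpha>'" "\<alpha>' T = \<beta> T"
      "\<And>u. u \<in> {T..t} \<Longrightarrow> f (\<alpha>' u) = \<gamma> u"
      using local_path_lift[OF cont opn fin lc _ \<open>T < 1\<close>, of \<gamma> "\<beta> T"] \<beta>(3)[of T] T0 by auto
    define \<delta> where "\<delta> u = (if u \<le> T then \<beta> u else \<alpha>' u)" for u
    have "continuous_on ({0..T} \<union> {T..t}) \<delta>"
      unfolding \<delta>_def using t(4) by (intro continuous_on_cases \<beta>(1) t(3)) auto
    moreover have "{0..T} \<union> {T..t} = {0..t}"
      using T0 t(1) by auto
    ultimately have "lifts t \<delta>"
      using \<beta> t T0 by (auto simp: lifts_def \<delta>_def)
    then have "t \<in> I" using t T0 by (auto simp: I_def)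
    then show False using T_up t(1) by fastforce
  qed
  with \<beta> show ?thesis by blast
qed

section \<open>Paths in spaces of bounded turning\<close>

text \<open>A continuum joining \<open>x\<close> and \<open>y\<close> has a net of bounded size at a
  fixed fraction of \<open>dist x y\<close>. Connectedness of the continuum makes the graph of
  nearby net points connected. Doubling makes the length \<open>M\<close> independent of
  \<open>x\<close> and \<open>y\<close>.\<close>

lemma bounded_turning_chain:
  fixes Y :: "'b::metric_space set"
  assumes Y: "doubling (UNIV :: 'b set)" and bt: "bounded_turning (UNIV :: 'b set)"
  obtains M :: nat and c :: real where "M \<ge> 1" "c \<ge> 1"
    "\<And>x y :: 'b. \<exists>q. q 0 = x \<and> q M = y \<and> (\<forall>i. dist (q i) (q (Suc i)) \<le> dist x y / 2) \<and>
      (\<forall>i. dist x (q i) \<le> c * dist x y)"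
proof -
  obtain c0 :: real where c0: "\<And>x y :: 'b. \<exists>K. compact K \<and> connected K \<and> x \<in> K \<and> y \<in> K \<and>
      diameter K \<le> c0 * dist x y"
    using bt unfolding bounded_turning_def by (metis UNIV_I)
  define c where "c = max 1 c0"
  obtain M0 :: nat where M0: "\<forall>r>0. \<forall>P\<subseteq>(UNIV :: 'b set).
    pairwise (\<lambda>x y. r \<le> dist x y) P \<longrightarrow> (\<forall>x\<in>P. \<forall>y\<in>P. dist x y \<le> (6 * c) * r) \<longrightarrow>
    finite P \<and> card P \<le> M0"
    using spec[OF Y[unfolded doubling_def], of "6 * c"] by (elim exE)
  \<comment> \<open>Exceeds the number of edges on at most \<open>M0 + 2\<close> vertices, which
    bounds the length of a connecting walk.\<close>
  define M where "M = (M0 + 2) * (M0 + 2) + 1"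
  have chain: "\<exists>q. q 0 = x \<and> q M = y \<and> (\<forall>i. dist (q i) (q (Suc i)) \<le> dist x y / 2) \<and>
      (\<forall>i. dist x (q i) \<le> c * dist x y)" for x y :: 'b
  proof (cases "x = y")
    case True
    then show ?thesis by (intro exI[of _ "\<lambda>_. x"]) simp
  next
    case False
    define r where "r = dist x y"
    have r: "r > 0" using False by (simp add: r_def)
    obtain K where K: "compact K" "connected K" "x \<in> K" "y \<in> K" "diameter K \<le> c0 * r"
      using c0[of x y] unfolding r_def by blast
    have "c0 * r \<le> c * r" using r by (intro mult_right_mono) (auto simp: c_def)
    then have diam: "dist u v \<le> c * r" if "u \<in> K" "v \<in> K" for u v
      using diameter_bounded_bound[OF compact_imp_bounded[OF K(1)] that] K(5) by linarith
    have "r / 6 > 0" using r by simp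
    then obtain P where P: "P \<subseteq> K" "pairwise (\<lambda>x y. r / 6 \<le> dist x y) P"
      "\<And>z. z \<in> K \<Longrightarrow> \<exists>p\<in>P. dist z p < r / 6"
      by (rule maximal_separated_subset) (rule that)
    have "\<forall>x\<in>P. \<forall>y\<in>P. dist x y \<le> (6 * c) * (r / 6)"
      using diam P(1) by auto
    then have finP: "finite P" "card P \<le> M0"
      using M0[rule_format, OF \<open>r / 6 > 0\<close> subset_UNIV P(2)] by simp_all
    define V where "V = insert x (insert y P)"
    have V: "finite V" "V \<subseteq> K" "card V \<le> M0 + 2"
      using finP P(1) K by (auto simp: V_def card_insert_if)
    define E where "E = {(p, q) \<in> V \<times> V. dist p q \<le> r / 2}"
    have finE: "finite E"
      by (rule finite_subset[of _ "V \<times> V"]) (use V in \<open>auto simp: E_def\<close>)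
    have "card E \<le> card (V \<times> V)"
      using V(1) by (intro card_mono) (auto simp: E_def)
    also have "\<dots> \<le> (M0 + 2) * (M0 + 2)"
      using V(3) by (simp only: card_cartesian_product mult_le_mono)
    finally have cardE: "card E < M" by (simp add: M_def)
    \<comment> \<open>Otherwise the balls of radius \<open>r / 6\<close> around reachable and around
      unreachable vertices would disconnect \<open>K\<close>: centres of overlapping balls are less
      than \<open>r / 2\<close> apart and so joined by an edge.\<close>
    have "(x, y) \<in> E\<^sup>*"
    proof (rule ccontr)
      assume no: "(x, y) \<notin> E\<^sup>*"
      define A where "A = (\<Union>p\<in>{p\<in>V. (x, p) \<in> E\<^sup>*}. ball p (r / 6))"
      define B where "B = (\<Union>p\<in>{p\<in>V. (x, p) \<notin> E\<^sup>*}. ball p (r / 6))"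
      have "open A" "open B" by (auto simp: A_def B_def)
      moreover have "K \<subseteq> A \<union> B"
      proof
        fix z assume "z \<in> K"
        then obtain p where "p \<in> P" "dist z p < r / 6" using P(3) by blast
        then have "p \<in> V" "z \<in> ball p (r / 6)" by (auto simp: V_def dist_commute)
        then show "z \<in> A \<union> B" unfolding A_def B_def by blast
      qed
      moreover have "A \<inter> B \<inter> K = {}"
      proof -
        have False if "p \<in> V" "(x, p) \<in> E\<^sup>*" "q \<in> V" "(x, q) \<notin> E\<^sup>*"
          "z \<in> ball p (r / 6)" "z \<in> ball q (r / 6)" for p q z
        proof -
          have "dist p q \<le> r / 2"
            using that(5,6) dist_triangle2[of p q z] r by (simp add: dist_commute)
          then have "(p, q) \<in> E" using that by (simp add: E_def)
          then show False using that(2,4) by (meson rtrancl.rtrancl_into_rtrancl)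
        qed
        then show ?thesis unfolding A_def B_def by blast
      qed
      moreover have "x \<in> A" "y \<in> B"
        using r no by (auto simp: A_def B_def V_def)
      ultimately show False
        using connectedD[OF K(2), of A B] K(3,4) by blast
    qed
    then obtain n where n: "n \<le> card E" "(x, y) \<in> E ^^ n"
      using rtrancl_finite_eq_relpow[OF finE] by auto
    then obtain g where g: "g 0 = x" "g n = y" "\<And>i. i < n \<Longrightarrow> (g i, g (Suc i)) \<in> E"
      by (auto simp: relpow_fun_conv)
    have gV: "g i \<in> V" if "i \<le> n" for i
    proof (cases i)
      case 0
      then show ?thesis using g(1) by (simp add: V_def)
    next
      case (Suc j)
      then show ?thesis using g(3)[of j] that by (auto simp: E_def)
    qed
    show ?thesis
    \<comment> \<open>Waiting at \<open>y\<close> pads the walk to the uniform length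
      \<open>M\<close>.\<close>
    proof (intro exI[of _ "\<lambda>i. g (min i n)"] conjI allI)
      show "g (min 0 n) = x" using g by simp
      show "g (min M n) = y" using g n(1) cardE by (simp add: min_def)
      show "dist (g (min i n)) (g (min (Suc i) n)) \<le> dist x y / 2" for i
        using g(3)[of i] r by (cases "i < n") (auto simp: E_def r_def min_def)
      show "dist x (g (min i n)) \<le> c * dist x y" for i
        using diam[of x "g (min i n)"] gV[of "min i n"] V(2) K(3) by (auto simp: r_def)
    qed
  qed
  have "M \<ge> 1" "c \<ge> 1" by (auto simp: M_def c_def)
  then show thesis using chain by (rule that)
qed

lemma nat_floor_mult_div:
  fixes t :: real
  assumes "M \<ge> 1" "t \<ge> 0"
  shows "nat \<lfloor>real M * t\<rfloor> div M = nat \<lfloor>t\<rfloor>"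
proof -
  have "\<lfloor>real M * t\<rfloor> div int M = \<lfloor>(real M * t) / of_int (int M)\<rfloor>"
    by (rule floor_divide_real_eq_div[symmetric]) simp
  also have "\<dots> = \<lfloor>t\<rfloor>" using assms(1) by simp
  finally have "nat (\<lfloor>real M * t\<rfloor> div int M) = nat \<lfloor>t\<rfloor>" by simp
  moreover have "nat (\<lfloor>real M * t\<rfloor> div int M) = nat \<lfloor>real M * t\<rfloor> div nat (int M)"
    using assms(2) by (intro nat_div_distrib) simp
  ultimately show ?thesis by simp
qed

text \<open>Chains are inserted between consecutive points again and again. Since each insertion
  halves the gaps, the step functions \<open>\<alpha> k\<close> on the subdivision into
  \<open>M ^ k\<close> intervals converge uniformly, and their jumps tend to 0, so the limit is
  continuous.\<close>

lemma bounded_turning_path: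
  fixes x y :: "'b::metric_space"
  assumes compl: "complete (UNIV :: 'b set)" and M: "M \<ge> (1::nat)" and c: "c \<ge> 1"
    and ch: "\<And>x y :: 'b. \<exists>q. q 0 = x \<and> q M = y \<and> (\<forall>i. dist (q i) (q (Suc i)) \<le> dist x y / 2) \<and>
      (\<forall>i. dist x (q i) \<le> c * dist x y)"
  shows "\<exists>\<gamma>. path \<gamma> \<and> pathstart \<gamma> = x \<and> pathfinish \<gamma> = y \<and>
    (\<forall>t\<in>{0..1}. dist x (\<gamma> t) \<le> (2 * c + 1) * dist x y)"
proof -
  define F where "F u v = (SOME q. q 0 = u \<and> q M = v \<and> (\<forall>i. dist (q i) (q (Suc i)) \<le> dist u v / 2) \<and>
      (\<forall>i. dist u (q i) \<le> c * dist u v))" for u v :: 'b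
  note F_all = someI_ex[OF ch, folded F_def]
  have F: "F u v 0 = u" "F u v M = v" "dist (F u v i) (F u v (Suc i)) \<le> dist u v / 2"
    "dist u (F u v i) \<le> c * dist u v" for u v i
    using F_all[of u v] by simp_all
  define D where "D = dist x y"
  \<comment> \<open>Entry \<open>j\<close> of level \<open>Suc k\<close> is entry
    \<open>j mod M\<close> of the chain inserted between entries \<open>j div M\<close> and
    \<open>Suc (j div M)\<close> of level \<open>k\<close>. Level 0 is constantly \<open>y\<close>
    from index 1 on, so the bound on gaps holds for all indices.\<close>
  define h where "h = rec_nat (\<lambda>j::nat. if j = 0 then x else y)
    (\<lambda>_ h' j. F (h' (j div M)) (h' (Suc (j div M))) (j mod M))"
  have h0: "h 0 j = (if j = 0 then x else y)" for j by (simp add: h_def)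
  have hS: "h (Suc k) j = F (h k (j div M)) (h k (Suc (j div M))) (j mod M)" for k j
    by (simp add: h_def)
  have step: "dist (h k j) (h k (Suc j)) \<le> D / 2 ^ k" for k j
  proof (induction k arbitrary: j)
    case 0
    then show ?case by (simp add: h0 D_def)
  next
    case (Suc k)
    let ?u = "h k (j div M)" and ?v = "h k (Suc (j div M))"
    have "h (Suc k) (Suc j) = F ?u ?v (Suc (j mod M))"
    proof (cases "Suc (j mod M) = M")
      case True
      then have "Suc j mod M = 0" "Suc j div M = Suc (j div M)"
        using M by (auto simp: mod_Suc div_Suc)
      then show ?thesis using True F(1,2) by (simp add: hS)
    next
      case False
      then have "Suc j mod M = Suc (j mod M)" "Suc j div M = j div M"
        by (auto simp: mod_Suc div_Suc)
      then show ?thesis by (simp add: hS)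
    qed
    then have "dist (h (Suc k) j) (h (Suc k) (Suc j)) \<le> dist ?u ?v / 2"
      using F(3)[of ?u ?v "j mod M"] by (simp add: hS)
    also have "\<dots> \<le> D / 2 ^ k / 2" using Suc.IH by simp
    finally show ?case by (simp add: mult.commute)
  qed
  have refine: "dist (h k (j div M)) (h (Suc k) j) \<le> c * (D / 2 ^ k)" for k j
  proof -
    have "dist (h k (j div M)) (h (Suc k) j) \<le> c * dist (h k (j div M)) (h k (Suc (j div M)))"
      using F(4) by (simp add: hS)
    also have "\<dots> \<le> c * (D / 2 ^ k)"
      using step c by (intro mult_left_mono) auto
    finally show ?thesis .
  qed
  define \<alpha> where "\<alpha> k t = h k (nat \<lfloor>real (M ^ k) * t\<rfloor>)" for k and t :: real
  have \<alpha>_step: "dist (\<alpha> k t) (\<alpha> (Suc k) t) \<le> c * D / 2 ^ k" if "t \<ge> 0" for k t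
  proof -
    have "nat \<lfloor>real (M ^ Suc k) * t\<rfloor> div M = nat \<lfloor>real (M ^ k) * t\<rfloor>"
      using nat_floor_mult_div[OF M, of "real (M ^ k) * t"] that by (simp add: mult.assoc)
    then show ?thesis
      using refine[of k "nat \<lfloor>real (M ^ Suc k) * t\<rfloor>"] by (simp add: \<alpha>_def)
  qed
  have D0: "D \<ge> 0" by (simp add: D_def)
  have tail: "dist (\<alpha> k t) (\<alpha> (k + n) t) \<le> 2 * c * D / 2 ^ k" if "t \<ge> 0" for k n t
  proof -
    \<comment> \<open>Subtracting the remaining tail of the geometric series makes the induction go
      through.\<close>
    have "dist (\<alpha> k t) (\<alpha> (k + n) t) \<le> 2 * c * D / 2 ^ k - 2 * c * D / 2 ^ (k + n)"
    proof (induction n)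
      case (Suc n)
      have "dist (\<alpha> k t) (\<alpha> (k + Suc n) t) \<le> dist (\<alpha> k t) (\<alpha> (k + n) t) + c * D / 2 ^ (k + n)"
        using dist_triangle[of "\<alpha> k t" "\<alpha> (k + Suc n) t" "\<alpha> (k + n) t"] \<alpha>_step[OF that, of "k + n"]
        by simp
      also have "\<dots> \<le> 2 * c * D / 2 ^ k - 2 * c * D / 2 ^ (k + Suc n)"
      proof -
        have "2 * c * D / 2 ^ (k + Suc n) = c * D / 2 ^ (k + n)" by simp
        moreover have "2 * c * D / 2 ^ (k + n) = 2 * (c * D / 2 ^ (k + n))" by simp
        ultimately show ?thesis using Suc by linarith
      qed
      finally show ?case .
    qed simp
    also have "\<dots> \<le> 2 * c * D / 2 ^ k" using c D0 by simp
    finally show ?thesis .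
  qed
  have small: "\<exists>k. C / 2 ^ k < e" if "e > 0" for C e :: real
  proof -
    obtain k where "C / e < 2 ^ k" using real_arch_pow[of 2 "C / e"] by auto
    then have "C / 2 ^ k < e" using that by (simp add: field_simps)
    then show ?thesis by blast
  qed
  have "\<exists>l. (\<lambda>k. \<alpha> k t) \<longlonglongrightarrow> l" if "t \<ge> 0" for t
  proof -
    have "Cauchy (\<lambda>k. \<alpha> k t)"
      unfolding Cauchy_altdef
    proof (intro allI impI)
      fix e :: real assume "e > 0"
      then obtain k where k: "2 * (2 * c * D) / 2 ^ k < e" using small by blast
      define q where "q = 2 * c * D / 2 ^ k"
      have "2 * q < e" using k by (simp add: q_def)
      have "dist (\<alpha> m t) (\<alpha> n t) < e" if "m \<ge> k" "n > m" for m n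
      proof -
        have "dist (\<alpha> k t) (\<alpha> m t) \<le> q" "dist (\<alpha> k t) (\<alpha> n t) \<le> q"
          using tail[OF \<open>t \<ge> 0\<close>, of k "m - k"] tail[OF \<open>t \<ge> 0\<close>, of k "n - k"] that
          by (auto simp: q_def)
        then show ?thesis
          using dist_triangle3[of "\<alpha> m t" "\<alpha> n t" "\<alpha> k t"] \<open>2 * q < e\<close> by linarith
      qed
      then show "\<exists>M. \<forall>m\<ge>M. \<forall>n>m. dist (\<alpha> m t) (\<alpha> n t) < e" by blast
    qed
    then show ?thesis using compl unfolding complete_def by auto
  qed
  then obtain \<gamma> where lim: "\<And>t. t \<ge> 0 \<Longrightarrow> (\<lambda>k. \<alpha> k t) \<longlonglongrightarrow> \<gamma> t" by metis
  have approx: "dist (\<alpha> k t) (\<gamma> t) \<le> 2 * c * D / 2 ^ k" if "t \<ge> 0" for k t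
  proof (rule tendsto_upperbound)
    show "(\<lambda>n. dist (\<alpha> k t) (\<alpha> (n + k) t)) \<longlonglongrightarrow> dist (\<alpha> k t) (\<gamma> t)"
      by (intro tendsto_intros LIMSEQ_ignore_initial_segment lim that)
    show "\<forall>\<^sub>F n in sequentially. dist (\<alpha> k t) (\<alpha> (n + k) t) \<le> 2 * c * D / 2 ^ k"
      using tail[OF that, of k] by (simp add: add.commute)
  qed simp
  have close: "dist (\<alpha> k s) (\<alpha> k t) \<le> D / 2 ^ k" if "0 \<le> s" "s \<le> t" "real (M ^ k) * (t - s) < 1" for k s t
  proof -
    have "\<lfloor>real (M ^ k) * t\<rfloor> = \<lfloor>real (M ^ k) * s\<rfloor> \<or> \<lfloor>real (M ^ k) * t\<rfloor> = \<lfloor>real (M ^ k) * s\<rfloor> + 1"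
    proof -
      have "real (M ^ k) * s \<le> real (M ^ k) * t" using that by (intro mult_left_mono) auto
      moreover have "real (M ^ k) * t < real (M ^ k) * s + 1" using that(3) by (simp add: algebra_simps)
      ultimately show ?thesis by linarith
    qed
    moreover have "0 \<le> \<lfloor>real (M ^ k) * s\<rfloor>" using that by simp
    ultimately have "nat \<lfloor>real (M ^ k) * t\<rfloor> = nat \<lfloor>real (M ^ k) * s\<rfloor> \<or>
        nat \<lfloor>real (M ^ k) * t\<rfloor> = Suc (nat \<lfloor>real (M ^ k) * s\<rfloor>)"
      by linarith
    then show ?thesis using step D0 by (auto simp: \<alpha>_def)
  qed
  have "continuous_on {0..1} \<gamma>"
    unfolding continuous_on_iff
  proof (intro ballI allI impI)
    fix s e :: real assume s: "s \<in> {0..1}" and "e > 0"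
    obtain k where k: "(4 * c + 1) * D / 2 ^ k < e" using small \<open>e > 0\<close> by blast
    have Mk: "real (M ^ k) > 0" using M by simp
    show "\<exists>d>0. \<forall>t\<in>{0..1}. dist t s < d \<longrightarrow> dist (\<gamma> t) (\<gamma> s) < e"
    proof (intro exI[of _ "1 / real (M ^ k)"] conjI ballI impI)
      fix t :: real assume t: "t \<in> {0..1}" "dist t s < 1 / real (M ^ k)"
      then have *: "real (M ^ k) * \<bar>t - s\<bar> < 1"
        using Mk by (simp add: dist_real_def field_simps)
      have "dist (\<alpha> k t) (\<alpha> k s) \<le> D / 2 ^ k"
      proof (cases "s \<le> t")
        case True
        then show ?thesis using close[of s t k] s * by (simp add: dist_commute)
      next
        case False
        then show ?thesis using close[of t s k] t * by simp
      qed
      moreover have "dist (\<alpha> k t) (\<gamma> t) \<le> 2 * c * D / 2 ^ k" "dist (\<alpha> k s) (\<gamma> s) \<le> 2 * c * D / 2 ^ k"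
        using approx s t by auto
      moreover have "dist (\<gamma> t) (\<gamma> s) \<le> dist (\<alpha> k t) (\<gamma> t) + dist (\<alpha> k t) (\<alpha> k s) + dist (\<alpha> k s) (\<gamma> s)"
        using dist_triangle3[of "\<gamma> t" "\<gamma> s" "\<alpha> k t"] dist_triangle[of "\<alpha> k t" "\<gamma> s" "\<alpha> k s"] by simp
      moreover have "2 * c * D / 2 ^ k + D / 2 ^ k + 2 * c * D / 2 ^ k = (4 * c + 1) * D / 2 ^ k"
        by (simp add: field_simps)
      ultimately show "dist (\<gamma> t) (\<gamma> s) < e" using k by linarith
    qed (use Mk in simp)
  qed
  then have "path \<gamma>" by (simp add: path_def)
  moreover have "pathstart \<gamma> = x"
  proof -
    have "h k 0 = x" for k
      by (induction k) (use M F(1) in \<open>auto simp: h0 hS\<close>)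
    then have "(\<lambda>k. \<alpha> k 0) \<longlonglongrightarrow> x" by (simp add: \<alpha>_def)
    then show ?thesis using lim[of 0] LIMSEQ_unique unfolding pathstart_def by blast
  qed
  moreover have "pathfinish \<gamma> = y"
  proof -
    have "h k (M ^ k) = y" for k
      by (induction k) (use M F(1) in \<open>auto simp: h0 hS\<close>)
    moreover have "nat \<lfloor>real (M ^ k) * 1\<rfloor> = M ^ k" for k
      by (metis floor_of_nat mult.right_neutral nat_int)
    ultimately have "(\<lambda>k. \<alpha> k 1) \<longlonglongrightarrow> y" by (simp add: \<alpha>_def)
    then show ?thesis using lim[of 1] LIMSEQ_unique unfolding pathfinish_def by force
  qed
  moreover have "dist x (\<gamma> t) \<le> (2 * c + 1) * dist x y" if "t \<in> {0..1}" for t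
  proof -
    have "dist x (\<alpha> 0 t) \<le> D" by (simp add: \<alpha>_def h0 D_def)
    then show ?thesis
      using approx[of t 0] that dist_triangle[of x "\<gamma> t" "\<alpha> 0 t"] by (simp add: D_def algebra_simps)
  qed
  ultimately show ?thesis by blast
qed

section \<open>Mappings of bounded diameter and length distortion\<close>

lemma max_multiplicity_finiteE:
  assumes "max_multiplicity f UNIV < \<infinity>"
  obtains N where "\<And>y. finite (f -` {y}) \<and> card (f -` {y}) \<le> N"
proof -
  obtain N where N: "max_multiplicity f UNIV = enat N"
    using assms by (cases "max_multiplicity f UNIV") auto
  have le: "(if finite (f -` {y}) then enat (card (f -` {y})) else \<infinity>) \<le> enat N" for y
    unfolding N[symmetric] max_multiplicity_def by (rule SUP_upper2[of y]) auto
  have "finite (f -` {y}) \<and> card (f -` {y}) \<le> N" for y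
    using le[of y] by (cases "finite (f -` {y})") auto
  then show thesis by (rule that)
qed

lemma diameter_le_dist:
  fixes S :: "'a::metric_space set"
  assumes "S \<noteq> {}" "\<And>x y. x \<in> S \<Longrightarrow> y \<in> S \<Longrightarrow> dist x y \<le> \<delta>"
  shows "diameter S \<le> \<delta>"
  using assms by (auto simp: diameter_def intro: cSUP_least)

lemma path_reparametrized_segment:
  fixes \<alpha> :: "real \<Rightarrow> 'a::topological_space"
  assumes "s \<le> t" "continuous_on {s..t} \<alpha>"
  shows "path (\<lambda>u. \<alpha> (s + u * (t - s)))"
  unfolding path_def
proof (rule continuous_on_compose2[OF assms(2)])
  show "continuous_on {0..1} (\<lambda>u. s + u * (t - s))" by (intro continuous_intros)
  show "(\<lambda>u. s + u * (t - s)) ` {0..1} \<subseteq> {s..t}"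
  proof (rule image_subsetI)
    fix u :: real assume "u \<in> {0..1}"
    then show "s + u * (t - s) \<in> {s..t}"
      using assms(1) mult_left_le_one_le[of "t - s" u] by auto
  qed
qed

lemma BDD_path_lift:
  fixes f :: "'a::metric_space \<Rightarrow> 'b::metric_space"
  assumes "BDD f" and cont: "continuous_on UNIV f" and opn: "open_map euclidean euclidean f"
    and fin: "\<And>y. finite (f -` {y})" and lc: "locally compact (UNIV :: 'a set)"
    and compl: "complete (UNIV :: 'a set)"
  obtains L where "L \<ge> 1"
    "\<And>\<gamma> x. path \<gamma> \<Longrightarrow> f x = pathstart \<gamma> \<Longrightarrow> \<exists>\<alpha>. path \<alpha> \<and> pathstart \<alpha> = x \<and>
      (\<forall>u\<in>{0..1}. f (\<alpha> u) = \<gamma> u) \<and> (\<forall>u\<in>{0..1}. dist x (\<alpha> u) \<le> L * diameter (path_image \<gamma>))"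
proof -
  obtain L where L: "L \<ge> 1" and bdd: "\<And>\<alpha>. nonconstant_curve \<alpha> \<Longrightarrow>
      inverse L * diameter (path_image \<alpha>) \<le> diameter (path_image (f \<circ> \<alpha>))"
    using assms(1) unfolding BDD_def by blast
  have "\<exists>\<alpha>. path \<alpha> \<and> pathstart \<alpha> = x \<and> (\<forall>u\<in>{0..1}. f (\<alpha> u) = \<gamma> u) \<and>
      (\<forall>u\<in>{0..1}. dist x (\<alpha> u) \<le> L * diameter (path_image \<gamma>))"
    if \<gamma>: "path \<gamma>" and x: "f x = pathstart \<gamma>" for \<gamma> x
  proof -
    have bd: "bounded (\<gamma> ` {s..t})" if "0 \<le> s" "t \<le> 1" for s t
    proof (rule bounded_subset)
      show "bounded (path_image \<gamma>)" using \<gamma> by (rule bounded_path_image)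
    qed (use that in \<open>auto simp: path_image_def\<close>)
    have mod: "dist (\<alpha> s) (\<alpha> t) \<le> L * diameter (\<gamma> ` {s..t})"
      if st: "0 \<le> s" "s \<le> t" "t \<le> 1" and \<alpha>: "continuous_on {s..t} \<alpha>" "\<And>u. u \<in> {s..t} \<Longrightarrow> f (\<alpha> u) = \<gamma> u"
      for s t \<alpha>
    proof -
      define \<beta> where "\<beta> u = \<alpha> (s + u * (t - s))" for u
      have \<beta>: "path \<beta>" unfolding \<beta>_def by (rule path_reparametrized_segment[OF st(2) \<alpha>(1)])
      have ends: "\<beta> 0 = \<alpha> s" "\<beta> 1 = \<alpha> t" by (simp_all add: \<beta>_def)
      show ?thesis
      proof (cases "nonconstant_curve \<beta>")
        case True
        have "f (\<beta> u) \<in> \<gamma> ` {s..t}" if "u \<in> {0..1}" for u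
        proof -
          have "s + u * (t - s) \<in> {s..t}"
            using that st mult_left_le_one_le[of "t - s" u] by auto
          then show ?thesis using \<alpha>(2) by (simp add: \<beta>_def)
        qed
        then have "path_image (f \<circ> \<beta>) \<subseteq> \<gamma> ` {s..t}"
          by (auto simp: path_image_def)
        then have "diameter (path_image (f \<circ> \<beta>)) \<le> diameter (\<gamma> ` {s..t})"
          by (rule diameter_subset[OF _ bd[OF st(1,3)]])
        then have "inverse L * diameter (path_image \<beta>) \<le> diameter (\<gamma> ` {s..t})"
          using bdd[OF True] by linarith
        then have "diameter (path_image \<beta>) \<le> L * diameter (\<gamma> ` {s..t})"
          using L by (simp add: field_simps)
        moreover have "dist (\<beta> 0) (\<beta> 1) \<le> diameter (path_image \<beta>)"
          using \<beta> by (intro diameter_bounded_bound bounded_path_image) (auto simp: path_image_def)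
        ultimately show ?thesis using ends by simp
      next
        case False
        then have "\<beta> 0 = \<beta> 1"
          using \<beta> unfolding nonconstant_curve_def constant_on_def by force
        then show ?thesis
          using ends L diameter_ge_0[OF bd[OF st(1,3)]] by simp
      qed
    qed
    have "\<exists>\<alpha>. continuous_on {0..1} \<alpha> \<and> \<alpha> 0 = x \<and> (\<forall>u\<in>{0..1}. f (\<alpha> u) = \<gamma> u)"
    proof (rule path_lift[OF cont opn fin lc compl _ _ mod])
      show "continuous_on {0..1} \<gamma>" using \<gamma> by (simp add: path_def)
      show "f x = \<gamma> 0" using x by (simp add: pathstart_def)
      fix e :: real assume e: "e > 0"
      have "uniformly_continuous_on {0..1} \<gamma>"
        using \<gamma> unfolding path_def by (intro compact_uniformly_continuous) auto
      moreover have "e / (2 * L) > 0" using e L by simp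
      ultimately obtain d where d: "d > 0"
        "\<And>u v. u \<in> {0..1} \<Longrightarrow> v \<in> {0..1} \<Longrightarrow> dist v u < d \<Longrightarrow> dist (\<gamma> v) (\<gamma> u) < e / (2 * L)"
        unfolding uniformly_continuous_on_def by blast
      have "L * diameter (\<gamma> ` {s..t}) < e" if st: "0 \<le> s" "s \<le> t" "t \<le> 1" "t - s < d" for s t
      proof -
        have "diameter (\<gamma> ` {s..t}) \<le> e / (2 * L)"
        proof (rule diameter_le_dist)
          fix y z assume "y \<in> \<gamma> ` {s..t}" "z \<in> \<gamma> ` {s..t}"
          then obtain u v where "u \<in> {s..t}" "v \<in> {s..t}" "y = \<gamma> u" "z = \<gamma> v" by blast
          then show "dist y z \<le> e / (2 * L)"
            using st d(2)[of v u] by (auto simp: dist_real_def intro!: less_imp_le)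
        qed (use st in simp)
        then have "L * diameter (\<gamma> ` {s..t}) \<le> L * (e / (2 * L))"
          using L by (intro mult_left_mono) auto
        also have "\<dots> < e" using L e by simp
        finally show ?thesis .
      qed
      then show "\<exists>d>0. \<forall>s t. 0 \<le> s \<longrightarrow> s \<le> t \<longrightarrow> t \<le> 1 \<longrightarrow> t - s < d \<longrightarrow> L * diameter (\<gamma> ` {s..t}) < e"
        using d(1) by blast
    qed
    then obtain \<alpha> where \<alpha>: "continuous_on {0..1} \<alpha>" "\<alpha> 0 = x" "\<forall>u\<in>{0..1}. f (\<alpha> u) = \<gamma> u"
      by blast
    have "dist x (\<alpha> u) \<le> L * diameter (path_image \<gamma>)" if u: "u \<in> {0..1}" for u
    proof -
      have "dist (\<alpha> 0) (\<alpha> u) \<le> L * diameter (\<gamma> ` {0..u})"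
        using u \<alpha> by (intro mod) (auto intro: continuous_on_subset)
      also have "\<dots> \<le> L * diameter (path_image \<gamma>)"
        using u L \<gamma> by (intro mult_left_mono diameter_subset bounded_path_image) (auto simp: path_image_def)
      finally show ?thesis using \<alpha>(2) by simp
    qed
    then show ?thesis
      using \<alpha> by (intro exI[of _ \<alpha>]) (auto simp: path_def pathstart_def)
  qed
  with L show thesis by (rule that)
qed

lemma bounded_turning_paths:
  assumes "bounded_turning (UNIV :: 'b::metric_space set)" "doubling (UNIV :: 'b set)"
    "complete (UNIV :: 'b set)"
  obtains C where "C \<ge> 1" "\<And>x y :: 'b. \<exists>\<gamma>. path \<gamma> \<and> pathstart \<gamma> = x \<and> pathfinish \<gamma> = y \<and>
    diameter (path_image \<gamma>) \<le> C * dist x y"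
proof -
  obtain M :: nat and c :: real where M: "M \<ge> 1" and c: "c \<ge> 1"
    and ch: "\<And>x y :: 'b. \<exists>q. q 0 = x \<and> q M = y \<and> (\<forall>i. dist (q i) (q (Suc i)) \<le> dist x y / 2) \<and>
      (\<forall>i. dist x (q i) \<le> c * dist x y)"
    by (rule bounded_turning_chain[OF assms(2,1)]) (rule that)
  have ex: "\<exists>\<gamma>. path \<gamma> \<and> pathstart \<gamma> = x \<and> pathfinish \<gamma> = y \<and>
      diameter (path_image \<gamma>) \<le> (2 * (2 * c + 1)) * dist x y" for x y :: 'b
  proof -
    obtain \<gamma> where \<gamma>: "path \<gamma>" "pathstart \<gamma> = x" "pathfinish \<gamma> = y"
      "\<And>t. t \<in> {0..1} \<Longrightarrow> dist x (\<gamma> t) \<le> (2 * c + 1) * dist x y"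
      using bounded_turning_path[OF assms(3) M c ch, of x y] by blast
    have "diameter (path_image \<gamma>) \<le> (2 * (2 * c + 1)) * dist x y"
    proof (rule diameter_le_dist)
      fix u v assume "u \<in> path_image \<gamma>" "v \<in> path_image \<gamma>"
      then have "dist x u \<le> (2 * c + 1) * dist x y" "dist x v \<le> (2 * c + 1) * dist x y"
        using \<gamma>(4) by (auto simp: path_image_def)
      then show "dist u v \<le> (2 * (2 * c + 1)) * dist x y"
        using dist_triangle3[of u v x] by (simp add: algebra_simps)
    qed (simp add: path_image_def)
    with \<gamma>(1-3) show ?thesis by blast
  qed
  show thesis by (rule that[OF _ ex]) (use c in simp)
qed

section \<open>Elementary bounds for the length of curves\<close>

lemma curve_length_le:
  assumes "\<And>u v. 0 \<le> u \<Longrightarrow> u \<le> v \<Longrightarrow> v \<le> 1 \<Longrightarrow> dist (\<alpha> u) (\<alpha> v) \<le> B * (v - u)" and "B \<ge> 0"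
  shows "curve_length \<alpha> \<le> ennreal B"
  unfolding curve_length_def
proof (rule SUP_least, drule CollectD)
  fix ts :: "real list" assume ts: "sorted ts \<and> set ts \<subseteq> {0..1}"
  define n where "n = length ts - 1"
  show "(\<Sum>i<length ts - 1. ennreal (dist (\<alpha> (ts ! i)) (\<alpha> (ts ! Suc i)))) \<le> ennreal B"
  proof (cases "n = 0")
    case False
    have mem: "ts ! i \<in> {0..1}" if "i \<le> n" for i
    proof -
      have "i < length ts" using that False by (simp add: n_def)
      then show ?thesis using ts nth_mem by blast
    qed
    have "dist (\<alpha> (ts ! i)) (\<alpha> (ts ! Suc i)) \<le> B * (ts ! Suc i - ts ! i)" if "i < n" for i
      using that ts mem[of i] mem[of "Suc i"] sorted_nth_mono[of ts i "Suc i"]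
      by (intro assms(1)) (auto simp: n_def)
    then have "(\<Sum>i<n. dist (\<alpha> (ts ! i)) (\<alpha> (ts ! Suc i))) \<le> (\<Sum>i<n. B * (ts ! Suc i - ts ! i))"
      by (intro sum_mono) simp
    also have "\<dots> = B * (ts ! n - ts ! 0)"
      by (simp add: sum_distrib_left[symmetric] sum_lessThan_telescope)
    also have "\<dots> \<le> B * 1"
      using mem[of n] mem[of 0] assms(2) by (intro mult_left_mono) auto
    finally show ?thesis
      by (simp add: sum_ennreal ennreal_leI n_def)
  qed (simp add: n_def)
qed

lemma dist_le_curve_length: "ennreal (dist (\<alpha> 0) (\<alpha> 1)) \<le> curve_length \<alpha>"
  unfolding curve_length_def by (rule SUP_upper2[of "[0, 1]"]) auto

text \<open>The fibre condition comes from lifting paths of \<open>Y\<close> with controlled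
  diameter. The upper diameter bound speaks of curves, whereas bounded turning of \<open>X\<close>
  provides only continua; local path connectedness of \<open>X\<close> bridges this gap.\<close>

theorem BDD_embeds:
  fixes f :: "'a::metric_space \<Rightarrow> 'b::metric_space"
  assumes X: "standing_space (UNIV :: 'a set)" and Y: "standing_space (UNIV :: 'b set)"
    and f: "branched_covering f" "BDD f" "max_multiplicity f UNIV < \<infinity>"
    and bt: "bounded_turning (UNIV :: 'a set)" "bounded_turning (UNIV :: 'b set)"
    and emb: "bilipschitz_embeds_Euclidean (UNIV :: 'b set)"
  shows "bilipschitz_embeds_Euclidean (UNIV :: 'a set)"
proof -
  have lc: "locally compact (UNIV :: 'a set)" and compl: "complete (UNIV :: 'a set)"
    and complY: "complete (UNIV :: 'b set)"
    using X Y by (auto simp: standing_space_def)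
  have cont: "continuous_on UNIV f" and opn: "open_map euclidean euclidean f"
    using f(1) by (auto simp: branched_covering_def)
  obtain N where N: "\<And>y. finite (f -` {y}) \<and> card (f -` {y}) \<le> N"
    by (rule max_multiplicity_finiteE[OF f(3)]) (rule that)
  then have fin: "finite (f -` {y})" for y by blast
  obtain L where L: "L \<ge> 1" and lift: "\<And>\<gamma> x. path \<gamma> \<Longrightarrow> f x = pathstart \<gamma> \<Longrightarrow> \<exists>\<alpha>. path \<alpha> \<and> pathstart \<alpha> = x \<and>
      (\<forall>u\<in>{0..1}. f (\<alpha> u) = \<gamma> u) \<and> (\<forall>u\<in>{0..1}. dist x (\<alpha> u) \<le> L * diameter (path_image \<gamma>))"
    by (rule BDD_path_lift[OF f(2) cont opn fin lc compl]) (rule that)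
  obtain C where C: "C \<ge> 1" and pathY: "\<And>x y :: 'b. \<exists>\<gamma>. path \<gamma> \<and> pathstart \<gamma> = x \<and> pathfinish \<gamma> = y \<and>
    diameter (path_image \<gamma>) \<le> C * dist x y"
    by (rule bounded_turning_paths[OF bt(2) bilipschitz_embeds_Euclidean_imp_doubling[OF emb] complY]) (rule that)
  have colift: "\<exists>\<alpha>. path \<alpha> \<and> pathstart \<alpha> = x' \<and> f (pathfinish \<alpha>) = y \<and>
      (\<forall>u\<in>{0..1}. dist x' (\<alpha> u) \<le> (L * C) * dist y (f x'))" for x' y
  proof -
    obtain \<gamma> where \<gamma>: "path \<gamma>" "pathstart \<gamma> = f x'" "pathfinish \<gamma> = y"
      "diameter (path_image \<gamma>) \<le> C * dist (f x') y"
      using pathY by blast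
    obtain \<alpha> where \<alpha>: "path \<alpha>" "pathstart \<alpha> = x'" "\<forall>u\<in>{0..1}. f (\<alpha> u) = \<gamma> u"
      "\<forall>u\<in>{0..1}. dist x' (\<alpha> u) \<le> L * diameter (path_image \<gamma>)"
      using lift[OF \<gamma>(1), of x'] \<gamma>(2) by auto
    have "L * diameter (path_image \<gamma>) \<le> (L * C) * dist y (f x')"
      using mult_left_mono[OF \<gamma>(4), of L] L by (simp add: dist_commute mult.assoc)
    moreover have "f (pathfinish \<alpha>) = y"
      using \<alpha>(3) \<gamma>(3) by (simp add: pathfinish_def)
    ultimately show ?thesis
      using \<alpha> by (intro exI[of _ \<alpha>]) fastforce
  qed
  have LC: "L * C \<ge> 1" using mult_mono[of 1 L 1 C] L C by simp
  have colip: "\<exists>x''. f x'' = f x \<and> dist x'' x' \<le> (L * C) * dist (f x) (f x')" for x x'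
  proof -
    obtain \<alpha> where "f (pathfinish \<alpha>) = f x" "\<forall>u\<in>{0..1}. dist x' (\<alpha> u) \<le> (L * C) * dist (f x) (f x')"
      using colift[of x' "f x"] by blast
    then show ?thesis
      by (intro exI[of _ "pathfinish \<alpha>"]) (simp add: pathfinish_def dist_commute)
  qed
  have lpc: "locally path_connected (UNIV :: 'a set)"
    unfolding locally_path_connected_im_kleinen
  proof (intro allI impI, elim conjE)
    fix V and x :: 'a assume V: "openin (top_of_set UNIV) V" "x \<in> V"
    then obtain e where e: "e > 0" "ball x e \<subseteq> V"
      by (metis open_contains_ball open_openin subtopology_UNIV)
    obtain \<rho> \<sigma> where \<rho>: "0 < \<rho>" "\<rho> < e" "\<And>z. z \<in> cball x \<rho> \<Longrightarrow> f z = f x \<Longrightarrow> z = x"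
      by (rule isolating_ball[OF cont fin lc e(1), of x]) (rule that)
    \<comment> \<open>From a point \<open>y\<close> this near to \<open>x\<close>, a path from
      \<open>f y\<close> to \<open>f x\<close> lifts without leaving \<open>ball x \<rho>\<close>.
      Its end lies in the fibre of \<open>f x\<close>, so it can only be \<open>x\<close>.\<close>
    define r where "r = \<rho> / (2 * (L * C))"
    have r: "r > 0" using \<rho>(1) LC by (simp add: r_def)
    have "open (f -` ball (f x) r)"
      using cont by (simp add: open_vimage)
    then have U: "open (ball x (\<rho> / 2) \<inter> f -` ball (f x) r)" by auto
    have "\<exists>p. path p \<and> path_image p \<subseteq> V \<and> pathstart p = x \<and> pathfinish p = y"
      if y: "y \<in> ball x (\<rho> / 2) \<inter> f -` ball (f x) r" for y
    proof -
      obtain \<alpha> where \<alpha>: "path \<alpha>" "pathstart \<alpha> = y" "f (pathfinish \<alpha>) = f x"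
        "\<forall>u\<in>{0..1}. dist y (\<alpha> u) \<le> (L * C) * dist (f x) (f y)"
        using colift[of y "f x"] by blast
      have "(L * C) * dist (f x) (f y) \<le> (L * C) * r"
        using y LC by (intro mult_left_mono) auto
      also have "\<dots> = \<rho> / 2" using L C by (simp add: r_def)
      finally have "dist x (\<alpha> u) < \<rho>" if "u \<in> {0..1}" for u
        using \<alpha>(4) that y dist_triangle[of x "\<alpha> u" y] by fastforce
      then have img: "path_image \<alpha> \<subseteq> ball x \<rho>" by (auto simp: path_image_def)
      then have "pathfinish \<alpha> \<in> cball x \<rho>"
        using pathfinish_in_path_image[of \<alpha>] by auto
      then have "pathfinish \<alpha> = x" using \<rho>(3) \<alpha>(3) by blast
      moreover have "path_image \<alpha> \<subseteq> V" using img e(2) \<rho>(2) by fastforce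
      ultimately show ?thesis
        using \<alpha>(1,2) by (intro exI[of _ "reversepath \<alpha>"]) simp
    qed
    moreover have "ball x (\<rho> / 2) \<inter> f -` ball (f x) r \<subseteq> V"
      using e(2) \<rho>(1,2) by fastforce
    ultimately show "\<exists>u. openin (top_of_set UNIV) u \<and> x \<in> u \<and> u \<subseteq> V \<and>
        (\<forall>y. y \<in> u \<longrightarrow> (\<exists>p. path p \<and> path_image p \<subseteq> V \<and> pathstart p = x \<and> pathfinish p = y))"
      using U r \<rho>(1) by (intro exI[of _ "ball x (\<rho> / 2) \<inter> f -` ball (f x) r"]) auto
  qed
  obtain L' where L': "L' \<ge> 1" and upper: "\<And>\<alpha>. nonconstant_curve \<alpha> \<Longrightarrow>
      diameter (path_image (f \<circ> \<alpha>)) \<le> L' * diameter (path_image \<alpha>)"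
    using f(2) unfolding BDD_def by blast
  obtain c0 where c0: "\<And>x y :: 'a. \<exists>K. compact K \<and> connected K \<and> x \<in> K \<and> y \<in> K \<and>
      diameter K \<le> c0 * dist x y"
    using bt(1) unfolding bounded_turning_def by auto
  define c where "c = max 1 c0"
  have lip: "dist (f x) (f x') \<le> (L' * (c + 2)) * dist x x'" for x x'
  proof (cases "x = x'")
    case False
    define d where "d = dist x x'"
    have d: "d > 0" using False by (simp add: d_def)
    obtain K where K: "compact K" "connected K" "x \<in> K" "x' \<in> K" "diameter K \<le> c0 * d"
      using c0[of x x'] by (auto simp: d_def)
    have "c0 * d \<le> c * d" using d by (intro mult_right_mono) (auto simp: c_def)
    \<comment> \<open>In the open neighbourhood \<open>U\<close> of \<open>K\<close>, components are
      path components, so \<open>x\<close> and \<open>x'\<close> are joined by a path, at the cost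
      of \<open>2 * d\<close> in diameter.\<close>
    define U where "U = (\<Union>z\<in>K. ball z d)"
    have U: "open U" "K \<subseteq> U" using d by (auto simp: U_def)
    have "locally path_connected U"
      using lpc U(1) by (intro locally_open_subset[of path_connected UNIV U]) auto
    then have "path_component U x x'"
      using K U(2) by (metis path_component_eq_connected_component connected_component_def)
    then obtain p where p: "path p" "path_image p \<subseteq> U" "pathstart p = x" "pathfinish p = x'"
      unfolding path_component_def by blast
    have nc: "nonconstant_curve p"
      using p False unfolding nonconstant_curve_def constant_on_def pathstart_def pathfinish_def by force
    have "diameter (path_image p) \<le> (c + 2) * d"
    proof (rule diameter_le_dist)
      fix u v assume "u \<in> path_image p" "v \<in> path_image p"
      then have "u \<in> U" "v \<in> U" using p(2) by auto
      then obtain u' v' where uv: "u' \<in> K" "v' \<in> K" "dist u' u < d" "dist v' v < d"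
        unfolding U_def by auto
      have "dist u' v' \<le> c * d"
        using diameter_bounded_bound[OF compact_imp_bounded[OF K(1)] uv(1,2)] K(5) \<open>c0 * d \<le> c * d\<close>
        by linarith
      then show "dist u v \<le> (c + 2) * d"
        using dist_triangle3[of u v u'] dist_triangle[of u' v v'] uv(3,4) by (simp add: algebra_simps)
    qed (simp add: path_image_def)
    then have "L' * diameter (path_image p) \<le> L' * ((c + 2) * d)"
      using L' by (intro mult_left_mono) auto
    moreover have "path (f \<circ> p)"
      using p(1) cont by (meson continuous_on_subset path_continuous_image subset_UNIV)
    then have "dist (f x) (f x') \<le> diameter (path_image (f \<circ> p))"
      using p(3,4) by (intro diameter_bounded_bound bounded_path_image)
        (auto simp: path_image_def pathstart_def pathfinish_def)
    ultimately show ?thesis using upper[OF nc] by (simp add: d_def mult.assoc)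
  qed simp
  have "L' * (c + 2) \<ge> 1"
    using mult_mono[of 1 L' 1 "c + 2"] L' by (simp add: c_def)
  from bilipschitz_embeds_Euclidean_pullback[OF emb lip this colip LC N] show ?thesis .
qed

text \<open>Along a segment the modulus is linear: the part over \<open>{s..t}\<close> has length at
  most \<open>norm (b - a) * (t - s)\<close>, and the lower length bound transfers this to the
  length, hence to the displacement, of the lift.\<close>

lemma BLD_linepath_lift:
  fixes g :: "'c::metric_space \<Rightarrow> 'v::real_normed_vector"
  assumes L: "L \<ge> 1" "\<And>\<alpha>. nonconstant_curve \<alpha> \<Longrightarrow>
      ennreal (inverse L) * curve_length \<alpha> \<le> curve_length (g \<circ> \<alpha>)"
    and st: "s \<le> t"
    and \<alpha>: "continuous_on {s..t} \<alpha>" "\<And>u. u \<in> {s..t} \<Longrightarrow> g (\<alpha> u) = linepath a b u"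
  shows "dist (\<alpha> s) (\<alpha> t) \<le> L * (norm (b - a) * (t - s))"
proof -
  define \<beta> where "\<beta> u = \<alpha> (s + u * (t - s))" for u
  have \<beta>: "path \<beta>" unfolding \<beta>_def by (rule path_reparametrized_segment[OF st \<alpha>(1)])
  have ends: "\<beta> 0 = \<alpha> s" "\<beta> 1 = \<alpha> t" by (simp_all add: \<beta>_def)
  have nonneg: "norm (b - a) * (t - s) \<ge> 0" using st by simp
  show ?thesis
  proof (cases "nonconstant_curve \<beta>")
    case True
    have g\<beta>: "g (\<beta> u) = linepath a b (s + u * (t - s))" if "0 \<le> u" "u \<le> 1" for u
      using \<alpha>(2)[of "s + u * (t - s)"] that st mult_left_le_one_le[of "t - s" u] by (simp add: \<beta>_def)
    have "curve_length (g \<circ> \<beta>) \<le> ennreal (norm (b - a) * (t - s))"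
    proof (rule curve_length_le[OF _ nonneg])
      fix u v :: real assume uv: "0 \<le> u" "u \<le> v" "v \<le> 1"
      have "linepath a b (s + u * (t - s)) - linepath a b (s + v * (t - s)) = ((u - v) * (t - s)) *\<^sub>R (b - a)"
        by (simp add: linepath_def algebra_simps)
      then show "dist ((g \<circ> \<beta>) u) ((g \<circ> \<beta>) v) \<le> norm (b - a) * (t - s) * (v - u)"
        using uv st g\<beta> by (simp add: dist_norm abs_mult)
    qed
    then have "ennreal (inverse L) * ennreal (dist (\<beta> 0) (\<beta> 1)) \<le> ennreal (norm (b - a) * (t - s))"
      using L(2)[OF True] dist_le_curve_length[of \<beta>]
      by (meson mult_left_mono order_trans zero_le)
    then have "inverse L * dist (\<beta> 0) (\<beta> 1) \<le> norm (b - a) * (t - s)"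
      using L(1) nonneg by (simp add: ennreal_mult[symmetric])
    then show ?thesis using L(1) ends by (simp add: field_simps)
  next
    case False
    then have "\<beta> 0 = \<beta> 1"
      using \<beta> unfolding nonconstant_curve_def constant_on_def by force
    then show ?thesis using ends L(1) nonneg by simp
  qed
qed

text \<open>Proved beside the BDD case rather than from it: segments in the target and short curves
  from quasiconvexity supply the two Lipschitz quotient estimates directly in terms of
  length.\<close>

theorem BLD_embeds:
  fixes g :: "'c::metric_space \<Rightarrow> real ^ 'n"
  assumes X: "standing_space (UNIV :: 'c set)" and qc: "quasiconvex (UNIV :: 'c set)"
    and g: "branched_covering g" "BLD g" "max_multiplicity g UNIV < \<infinity>"
  shows "bilipschitz_embeds_Euclidean (UNIV :: 'c set)"
proof -
  have lc: "locally compact (UNIV :: 'c set)" and compl: "complete (UNIV :: 'c set)"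
    using X by (auto simp: standing_space_def)
  have cont: "continuous_on UNIV g" and opn: "open_map euclidean euclidean g"
    using g(1) by (auto simp: branched_covering_def)
  obtain N where N: "\<And>y. finite (g -` {y}) \<and> card (g -` {y}) \<le> N"
    by (rule max_multiplicity_finiteE[OF g(3)]) (rule that)
  then have fin: "finite (g -` {y})" for y by blast
  obtain L where L: "L \<ge> 1"
    and lower: "\<And>\<alpha>. nonconstant_curve \<alpha> \<Longrightarrow> ennreal (inverse L) * curve_length \<alpha> \<le> curve_length (g \<circ> \<alpha>)"
    and upper: "\<And>\<alpha>. nonconstant_curve \<alpha> \<Longrightarrow> curve_length (g \<circ> \<alpha>) \<le> ennreal L * curve_length \<alpha>"
    using g(2) unfolding BLD_def by blast
  have colip: "\<exists>x''. g x'' = g x \<and> dist x'' x' \<le> L * dist (g x) (g x')" for x x'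
  proof -
    let ?B = "norm (g x - g x')"
    have mod: "dist (\<alpha> s) (\<alpha> t) \<le> L * (?B * (t - s))"
      if "s \<le> t" "continuous_on {s..t} \<alpha>" "\<And>u. u \<in> {s..t} \<Longrightarrow> g (\<alpha> u) = linepath (g x') (g x) u" for s t \<alpha>
      using BLD_linepath_lift[OF L lower that] by simp
    have "\<exists>\<alpha>. continuous_on {0..1} \<alpha> \<and> \<alpha> 0 = x' \<and> (\<forall>u\<in>{0..1}. g (\<alpha> u) = linepath (g x') (g x) u)"
    proof (rule path_lift[OF cont opn fin lc compl _ _ mod])
      show "continuous_on {0..1} (linepath (g x') (g x))"
        by (intro continuous_intros)
      show "g x' = linepath (g x') (g x) 0" by (simp add: linepath_def)
      fix e :: real assume e: "e > 0"
      \<comment> \<open>The summand 1 keeps the divisor positive when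
        \<open>g x = g x'\<close>.\<close>
      have pos: "L * ?B + 1 > 0" using L by (simp add: add_nonneg_pos)
      have "L * (?B * (t - s)) < e" if "s \<le> t" "t - s < e / (L * ?B + 1)" for s t
      proof -
        have "L * ?B * (t - s) \<le> (L * ?B + 1) * (t - s)"
          using that(1) by (intro mult_right_mono) auto
        also have "\<dots> < e" using that(2) pos by (simp add: field_simps)
        finally show ?thesis by (simp add: mult.assoc)
      qed
      then show "\<exists>d>0. \<forall>s t. 0 \<le> s \<longrightarrow> s \<le> t \<longrightarrow> t \<le> 1 \<longrightarrow> t - s < d \<longrightarrow> L * (?B * (t - s)) < e"
        using e pos by (intro exI[of _ "e / (L * ?B + 1)"]) auto
    qed
    then obtain \<alpha> where \<alpha>: "continuous_on {0..1} \<alpha>" "\<alpha> 0 = x'"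
      "\<forall>u\<in>{0..1}. g (\<alpha> u) = linepath (g x') (g x) u"
      by blast
    have "dist (\<alpha> 0) (\<alpha> 1) \<le> L * (?B * (1 - 0))"
      using \<alpha> by (intro mod) auto
    then have "dist (\<alpha> 1) x' \<le> L * dist (g x) (g x')"
      using \<alpha>(2) by (simp add: dist_norm dist_commute)
    moreover have "g (\<alpha> 1) = g x" using \<alpha>(3) by (simp add: linepath_def)
    ultimately show ?thesis by blast
  qed
  obtain C0 where C0: "\<And>x y :: 'c. \<exists>\<alpha>. path \<alpha> \<and> pathstart \<alpha> = x \<and> pathfinish \<alpha> = y \<and>
    curve_length \<alpha> \<le> ennreal (C0 * dist x y)"
    using qc unfolding quasiconvex_def by auto
  define C where "C = max 1 C0"
  have lip: "dist (g x) (g x') \<le> (L * C) * dist x x'" for x x'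
  proof (cases "x = x'")
    case False
    obtain \<alpha> where \<alpha>: "path \<alpha>" "\<alpha> 0 = x" "\<alpha> 1 = x'" "curve_length \<alpha> \<le> ennreal (C0 * dist x x')"
      using C0[of x x'] by (auto simp: pathstart_def pathfinish_def)
    have nc: "nonconstant_curve \<alpha>"
      using \<alpha> False unfolding nonconstant_curve_def constant_on_def by force
    have "C0 * dist x x' \<le> C * dist x x'" by (intro mult_right_mono) (auto simp: C_def)
    then have "curve_length \<alpha> \<le> ennreal (C * dist x x')"
      using \<alpha>(4) ennreal_leI order_trans by blast
    then have "ennreal L * curve_length \<alpha> \<le> ennreal L * ennreal (C * dist x x')"
      by (intro mult_left_mono) auto
    moreover have "ennreal (dist (g x) (g x')) \<le> curve_length (g \<circ> \<alpha>)"
      using dist_le_curve_length[of "g \<circ> \<alpha>"] \<alpha>(2,3) by simp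
    ultimately have "ennreal (dist (g x) (g x')) \<le> ennreal L * ennreal (C * dist x x')"
      using upper[OF nc] by (meson order_trans)
    also have "\<dots> = ennreal (L * C * dist x x')"
      using L by (simp add: ennreal_mult[symmetric] C_def mult.assoc)
    finally show ?thesis
      using L by (simp add: C_def)
  qed simp
  have "L * C \<ge> 1" using mult_mono[of 1 L 1 C] L by (simp add: C_def)
  from bilipschitz_embeds_Euclidean_pullback[OF bilipschitz_embeds_Euclidean_vec lip this colip L N]
  show ?thesis .
qed

theorem corollary8p2:
  fixes f :: "'a::metric_space \<Rightarrow> 'b::metric_space"
    and g :: "'c::metric_space \<Rightarrow> real ^ 'n"
  shows "(standing_space (UNIV :: 'a set) \<and> standing_space (UNIV :: 'b set) \<and>
      branched_covering f \<and> BDD f \<and> max_multiplicity f UNIV < \<infinity> \<and>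
      bounded_turning (UNIV :: 'a set) \<and> bounded_turning (UNIV :: 'b set) \<and>
      bilipschitz_embeds_Euclidean (UNIV :: 'b set)
        \<longrightarrow> bilipschitz_embeds_Euclidean (UNIV :: 'a set)) \<and>
    (standing_space (UNIV :: 'c set) \<and> quasiconvex (UNIV :: 'c set) \<and>
      branched_covering g \<and> BLD g \<and> max_multiplicity g UNIV < \<infinity>
        \<longrightarrow> bilipschitz_embeds_Euclidean (UNIV :: 'c set))"
proof (intro conjI impI; elim conjE)
  show "bilipschitz_embeds_Euclidean (UNIV :: 'a set)"
    if "standing_space (UNIV :: 'a set)" "standing_space (UNIV :: 'b set)" "branched_covering f" "BDD f"
      "max_multiplicity f UNIV < \<infinity>" "bounded_turning (UNIV :: 'a set)"
      "bounded_turning (UNIV :: 'b set)" "bilipschitz_embeds_Euclidean (UNIV :: 'b set)"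
    using that by (rule BDD_embeds)
  show "bilipschitz_embeds_Euclidean (UNIV :: 'c set)"
    if "standing_space (UNIV :: 'c set)" "quasiconvex (UNIV :: 'c set)" "branched_covering g" "BLD g"
      "max_multiplicity g UNIV < \<infinity>"
    using that by (rule BLD_embeds)
qed

end
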